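(* Let $\nu,\lambda>0$, $\rho\in H^{-1}(\mathbb T^d)$, and let $f:L^2(\mathbb T^d)\to L^2(\mathbb T^d)$ be continuous, bounded uniformly from below on the positive elements of $L^2(\mathbb T^d)$, and $\alpha$ monotone for some $\alpha>0$. Let $J\subset\mathbb T^d$ be a finite set, let $k=k(x,\xi)$ be a smooth non-negative function such that $x\mapsto\inf_{\xi\in J}k(x,\xi)$ belongs to $W^{2,\infty}$ and such that there is $k_0>0$ with $k(x,\xi)\ge k_0$ for all $x\in\mathbb T^d$, $\xi\in J$, and set $$Mv(x)=\inf_{\xi\in J}\{k(x,\xi)+v(x+\xi)\}.$$ Let $0<\delta<2\alpha$, $L=-\nu\Delta+\lambda\,\mathrm{Id}$ and $K'=\{g\in L^2(\mathbb T^d): L^{-1}g\le M(L^{-1}g)\}$. For any $u_0\in H^2(\mathbb T^d)$ with $u_0\le Mu_0$, let $(u_n,m_n)_{n\ge0}$ be defined by: $m_n\in L^2(\mathbb T^d)$, $m_n\ge0$, is such that $$\int_{\mathbb T^d}(f(m_n)+\nu\Delta u_n-\lambda u_n)(\mu-m_n)\ge0\quad\forall\mu\in L^2(\mathbb T^d),\ \mu\ge0,$$ and $u_{n+1}\in H^2(\mathbb T^d)$ is defined by $$Lu_{n+1}=\mathbf P_{K'}\big(Lu_n-\delta(m_n-L^{-1}\rho)\big).$$ Then $(m_n)_{n\ge0}$ converges to $m$ in $L^2(\mathbb T^d)$, where $(u,m)\in H^2(\mathbb T^d)\times H^1(\mathbb T^d)$ is the only solution of the system $$\begin{cases}(f(m)+\nu\Delta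 u-\lambda u,\,v-u)_{H^{-1}\times H^1}\le0,&\forall v\in H^1(\mathbb T^d),\ v\le Mu;\\ (-\nu\Delta m+\lambda m-\rho,\,v-u)_{H^{-1}\times H^1}\ge0,&\forall v\in H^1(\mathbb T^d),\ v\le Mv;\\ \int_{\mathbb T^d}(f(m)+\nu\Delta u-\lambda u)\,m=0;\\ u\le Mu;\quad m\ge0.\end{cases}$$
   Context: $\mathbb T^d$ is the $d$-dimensional torus. A map $f:L^2(\mathbb T^d)\to L^2(\mathbb T^d)$ is $\alpha$ monotone if $\int_{\mathbb T^d}(f(m)-f(m'))(m-m')\ge\alpha\|m-m'\|_{L^2}^2$ for all $m,m'\in L^2(\mathbb T^d)$. $\mathbf P_A$ denotes the orthogonal projection in $L^2(\mathbb T^d)$ onto the closed convex set $A$. Inequalities between functions are a.e. Here $\rho$ is the entry rate of players (a mean field game of impulse control). Existence and uniqueness of the solution $(u,m)\in H^2(\mathbb T^d)\times H^1(\mathbb T^d)$ of the system is taken as known (it is a recalled result for $f$ strictly monotone, i.e. $\int_{\mathbb T^d}(f(m)-f(m'))(m-m')>0$ whenever $m\ne m'$, and for $k$ smooth and non-negative such that $x\mapsto\inf_{\xi\in J}k(x,\xi)$ belongs to $W^{2,\infty}$ and there is $k_0>0$ with $k(x,\xi)\ge k_0$ for all $x\in\mathbb T^d$, $\xi\in J$). *)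

theory Defs
  imports "HOL-Analysis.Analysis"
begin

text \<open>
  The torus is \<open>\<real>\<^sup>d / \<int>\<^sup>d\<close>: functions on it are functions on the whole space that are
  1-periodic in every coordinate, integrated over the unit cube. Points of the torus are
  represented by points of the space.
\<close>

definition periodic :: "('a::euclidean_space \<Rightarrow> 'b) \<Rightarrow> bool"
  where "periodic f \<longleftrightarrow> (\<forall>x. \<forall>b\<in>Basis. f (x + b) = f x)"

definition torus :: "'a::euclidean_space measure"
  where "torus = restrict_space lborel (cbox 0 One)"

primrec Ck :: "nat \<Rightarrow> ('a::euclidean_space \<Rightarrow> real) \<Rightarrow> bool"
  where
    "Ck 0 f \<longleftrightarrow> continuous_on UNIV f"
  | "Ck (Suc n) f \<longleftrightarrow>
      f differentiable_on UNIV \<and> (\<forall>b\<in>Basis. Ck n (\<lambda>x. frechet_derivative f (at x) b))"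

definition smooth :: "('a::euclidean_space \<Rightarrow> real) \<Rightarrow> bool"
  where "smooth f \<longleftrightarrow> (\<forall>n. Ck n f)"


section \<open>The Hilbert space of square integrable functions on the torus\<close>

definition sq_int :: "('a::euclidean_space \<Rightarrow> real) \<Rightarrow> bool"
  where "sq_int f \<longleftrightarrow>
    f \<in> borel_measurable borel \<and> periodic f \<and> integrable torus (\<lambda>x. (f x)\<^sup>2)"

definition L2_rel :: "('a::euclidean_space \<Rightarrow> real) \<Rightarrow> ('a \<Rightarrow> real) \<Rightarrow> bool"
  where "L2_rel f g \<longleftrightarrow> sq_int f \<and> sq_int g \<and> (AE x in torus. f x = g x)"

lemma sq_int_zero: "sq_int (\<lambda>_. 0)"
  by (simp add: sq_int_def periodic_def)

quotient_type (overloaded) 'a L2 = "'a::euclidean_space \<Rightarrow> real" / partial: L2_rel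
proof (rule part_equivpI)
  show "\<exists>f. L2_rel f (f::'a \<Rightarrow> real)"
    using sq_int_zero by (auto simp: L2_rel_def)
  show "symp (L2_rel :: ('a \<Rightarrow> real) \<Rightarrow> _)"
    by (auto simp: symp_def L2_rel_def)
  show "transp (L2_rel :: ('a \<Rightarrow> real) \<Rightarrow> _)"
  proof (rule transpI)
    fix f g h :: "'a \<Rightarrow> real"
    assume fg: "L2_rel f g" and gh: "L2_rel g h"
    have "AE x in torus. f x = g x" "AE x in torus. g x = h x"
      using fg gh by (auto simp: L2_rel_def)
    then have "AE x in torus. f x = h x"
      by eventually_elim simp
    then show "L2_rel f h"
      using fg gh by (auto simp: L2_rel_def)
  qed
qed

lemma borel_measurable_torus: "f \<in> borel_measurable borel \<Longrightarrow> f \<in> borel_measurable torus"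
  unfolding torus_def by (intro measurable_restrict_space1) simp

lemma sq_int_borel_torus: "sq_int f \<Longrightarrow> f \<in> borel_measurable torus"
  by (simp add: sq_int_def borel_measurable_torus)

lemma sq_int_mult_integrable:
  assumes "sq_int f" "sq_int g"
  shows "integrable torus (\<lambda>x. f x * g x)"
proof (rule Bochner_Integration.integrable_bound)
  show "integrable torus (\<lambda>x. (f x)\<^sup>2 + (g x)\<^sup>2)"
    using assms by (intro Bochner_Integration.integrable_add) (auto simp: sq_int_def)
  show "(\<lambda>x. f x * g x) \<in> borel_measurable torus"
    using assms[THEN sq_int_borel_torus] by measurable
  have "\<bar>a * b\<bar> \<le> a\<^sup>2 + b\<^sup>2" for a b :: real
  proof -
    have "2 * (\<bar>a\<bar> * \<bar>b\<bar>) \<le> a\<^sup>2 + b\<^sup>2"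
      using sum_squares_bound[of "\<bar>a\<bar>" "\<bar>b\<bar>"] by (simp add: mult.assoc)
    moreover have "0 \<le> \<bar>a\<bar> * \<bar>b\<bar>"
      by simp
    ultimately show ?thesis
      unfolding abs_mult by linarith
  qed
  then show "AE x in torus. norm (f x * g x) \<le> norm ((f x)\<^sup>2 + (g x)\<^sup>2)"
    by (intro AE_I2) (simp add: order_trans[OF _ abs_ge_self])
qed

lemma sq_int_add:
  assumes f: "sq_int f" and g: "sq_int g"
  shows "sq_int (\<lambda>x. f x + g x)"
proof -
  have "integrable torus (\<lambda>x. (f x)\<^sup>2 + (g x)\<^sup>2 + 2 * (f x * g x))"
    using f g sq_int_mult_integrable[OF f g] by (auto simp: sq_int_def)
  moreover have "(\<lambda>x. (f x)\<^sup>2 + (g x)\<^sup>2 + 2 * (f x * g x)) = (\<lambda>x. (f x + g x)\<^sup>2)"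
    by (auto simp: power2_eq_square algebra_simps)
  ultimately show ?thesis
    using f g by (auto simp: sq_int_def periodic_def)
qed

lemma sq_int_cmult: "sq_int f \<Longrightarrow> sq_int (\<lambda>x. c * f x)"
  by (auto simp: sq_int_def periodic_def power_mult_distrib)

instantiation L2 :: (euclidean_space) real_vector
begin

lift_definition zero_L2 :: "'a L2" is "\<lambda>_. 0"
  using sq_int_zero by (auto simp: L2_rel_def)

lift_definition plus_L2 :: "'a L2 \<Rightarrow> 'a L2 \<Rightarrow> 'a L2" is "\<lambda>f g x. f x + g x"
  by (auto simp: L2_rel_def intro: sq_int_add)

lift_definition scaleR_L2 :: "real \<Rightarrow> 'a L2 \<Rightarrow> 'a L2" is "\<lambda>c f x. c * f x"
  by (auto simp: L2_rel_def intro: sq_int_cmult)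

definition uminus_L2 :: "'a L2 \<Rightarrow> 'a L2" where "uminus_L2 u = (-1) *\<^sub>R u"

definition minus_L2 :: "'a L2 \<Rightarrow> 'a L2 \<Rightarrow> 'a L2" where "minus_L2 u v = u + (-1) *\<^sub>R v"

instance
proof
  fix u v w :: "'a L2" and a b :: real
  show "u + v + w = u + (v + w)"
    by transfer (auto simp: L2_rel_def algebra_simps intro!: sq_int_add)
  show "u + v = v + u"
    by transfer (auto simp: L2_rel_def algebra_simps intro!: sq_int_add)
  show "0 + u = u"
    by transfer (auto simp: L2_rel_def)
  show "- u + u = 0"
    unfolding uminus_L2_def
    by transfer (auto simp: L2_rel_def sq_int_zero)
  show "u - v = u + - v"
    by (simp add: uminus_L2_def minus_L2_def)
  show "a *\<^sub>R (u + v) = a *\<^sub>R u + a *\<^sub>R v"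
  proof transfer
    fix a and f g :: "'a \<Rightarrow> real"
    assume "L2_rel f f" "L2_rel g g"
    then have "sq_int (\<lambda>x. a * (f x + g x))"
      by (intro sq_int_cmult sq_int_add) (auto simp: L2_rel_def)
    then show "L2_rel (\<lambda>x. a * (f x + g x)) (\<lambda>x. a * f x + a * g x)"
      by (simp add: L2_rel_def algebra_simps)
  qed
  show "(a + b) *\<^sub>R u = a *\<^sub>R u + b *\<^sub>R u"
  proof transfer
    fix a b and f :: "'a \<Rightarrow> real"
    assume "L2_rel f f"
    then have "sq_int (\<lambda>x. (a + b) * f x)"
      by (intro sq_int_cmult) (auto simp: L2_rel_def)
    then show "L2_rel (\<lambda>x. (a + b) * f x) (\<lambda>x. a * f x + b * f x)"
      by (simp add: L2_rel_def algebra_simps)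
  qed
  show "a *\<^sub>R b *\<^sub>R u = (a * b) *\<^sub>R u"
  proof transfer
    fix a b and f :: "'a \<Rightarrow> real"
    assume "L2_rel f f"
    then have "sq_int (\<lambda>x. (a * b) * f x)"
      by (intro sq_int_cmult) (auto simp: L2_rel_def)
    then show "L2_rel (\<lambda>x. a * (b * f x)) (\<lambda>x. a * b * f x)"
      by (simp add: L2_rel_def algebra_simps)
  qed
  show "1 *\<^sub>R u = u"
    by transfer (auto simp: L2_rel_def)
qed

end

instantiation L2 :: (euclidean_space) real_inner
begin

lift_definition inner_L2 :: "'a L2 \<Rightarrow> 'a L2 \<Rightarrow> real" is "\<lambda>f g. \<integral>x. f x * g x \<partial>torus"
proof -
  fix f f' g g' :: "'a \<Rightarrow> real"
  assume f: "L2_rel f f'" and g: "L2_rel g g'"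
  have "AE x in torus. f x = f' x" "AE x in torus. g x = g' x"
    using f g by (auto simp: L2_rel_def)
  then have "AE x in torus. f x * g x = f' x * g' x"
    by eventually_elim simp
  then show "(\<integral>x. f x * g x \<partial>torus) = (\<integral>x. f' x * g' x \<partial>torus)"
    using f g by (intro integral_cong_AE borel_measurable_times sq_int_borel_torus)
      (auto simp: L2_rel_def)
qed

definition norm_L2 :: "'a L2 \<Rightarrow> real" where "norm_L2 u = sqrt (inner u u)"

definition sgn_L2 :: "'a L2 \<Rightarrow> 'a L2" where "sgn_L2 u = u /\<^sub>R norm u"

definition dist_L2 :: "'a L2 \<Rightarrow> 'a L2 \<Rightarrow> real" where "dist_L2 u v = norm (u - v)"

definition uniformity_L2 :: "('a L2 \<times> 'a L2) filter"
  where "uniformity_L2 = (INF e\<in>{0 <..}. principal {(u, v). dist u v < e})"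

definition open_L2 :: "'a L2 set \<Rightarrow> bool"
  where "open_L2 U \<longleftrightarrow> (\<forall>u\<in>U. eventually (\<lambda>(u', v). u' = u \<longrightarrow> v \<in> U) uniformity)"

instance
proof
  fix u v w :: "'a L2" and c :: real and U :: "'a L2 set"
  show "dist u v = norm (u - v)" by (rule dist_L2_def)
  show "sgn u = u /\<^sub>R norm u" by (rule sgn_L2_def)
  show "(uniformity :: ('a L2 \<times> 'a L2) filter) = (INF e\<in>{0 <..}. principal {(u, v). dist u v < e})"
    by (rule uniformity_L2_def)
  show "open U \<longleftrightarrow> (\<forall>u\<in>U. \<forall>\<^sub>F (u', v) in uniformity. u' = u \<longrightarrow> v \<in> U)"
    by (rule open_L2_def)
  show "norm u = sqrt (inner u u)" by (rule norm_L2_def)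
  show "inner u v = inner v u"
    by transfer (simp add: mult.commute)
  show "inner (u + v) w = inner u w + inner v w"
    by transfer (simp add: L2_rel_def algebra_simps sq_int_mult_integrable)
  show "inner (c *\<^sub>R u) v = c * inner u v"
    by transfer (simp add: mult.assoc)
  show "0 \<le> inner u u"
    by transfer simp
  show "inner u u = 0 \<longleftrightarrow> u = 0"
  proof transfer
    fix f :: "'a \<Rightarrow> real"
    assume "L2_rel f f"
    then have f: "sq_int f" by (simp add: L2_rel_def)
    have "(\<integral>x. f x * f x \<partial>torus) = 0 \<longleftrightarrow> (AE x in torus. f x * f x = 0)"
      by (rule integral_nonneg_eq_0_iff_AE) (auto intro: sq_int_mult_integrable f)
    then show "(\<integral>x. f x * f x \<partial>torus) = 0 \<longleftrightarrow> L2_rel f (\<lambda>_. 0)"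
      by (simp add: L2_rel_def f sq_int_zero)
  qed
qed

end

text \<open>
  A periodic representative of a class; it is unspecified on null sets, and everything below
  depends on it only up to null sets.
\<close>

abbreviation L2_fun :: "'a::euclidean_space L2 \<Rightarrow> 'a \<Rightarrow> real"
  where "L2_fun \<equiv> rep_L2"

definition nonneg :: "'a::euclidean_space L2 \<Rightarrow> bool"
  where "nonneg u \<longleftrightarrow> (AE x in torus. 0 \<le> L2_fun u x)"


section \<open>Sobolev spaces\<close>

definition has_weak_deriv :: "'a::euclidean_space \<Rightarrow> 'a L2 \<Rightarrow> 'a L2 \<Rightarrow> bool"
  where "has_weak_deriv b u w \<longleftrightarrow>
    (\<forall>\<phi>. smooth \<phi> \<and> periodic \<phi> \<longrightarrow>
      (\<integral>x. L2_fun u x * frechet_derivative \<phi> (at x) b \<partial>torus) = - (\<integral>x. L2_fun w x * \<phi> x \<partial>torus))"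

definition weak_deriv :: "'a::euclidean_space \<Rightarrow> 'a L2 \<Rightarrow> 'a L2"
  where "weak_deriv b u = (THE w. has_weak_deriv b u w)"

definition H1 :: "'a::euclidean_space L2 set"
  where "H1 = {u. \<forall>b\<in>Basis. \<exists>w. has_weak_deriv b u w}"

definition H2 :: "'a::euclidean_space L2 set"
  where "H2 = {u \<in> H1. \<forall>b\<in>Basis. weak_deriv b u \<in> H1}"

definition H1_norm :: "'a::euclidean_space L2 \<Rightarrow> real"
  where "H1_norm u = sqrt ((norm u)\<^sup>2 + (\<Sum>b\<in>Basis. (norm (weak_deriv b u))\<^sup>2))"

text \<open>The dual of \<open>H1\<close>; only the values of a functional on \<open>H1\<close> are meaningful.\<close>

definition H_minus1 :: "('a::euclidean_space L2 \<Rightarrow> real) set"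
  where "H_minus1 = {\<rho>.
    (\<forall>u\<in>H1. \<forall>v\<in>H1. \<rho> (u + v) = \<rho> u + \<rho> v) \<and>
    (\<forall>c. \<forall>u\<in>H1. \<rho> (c *\<^sub>R u) = c * \<rho> u) \<and>
    (\<exists>C. \<forall>u\<in>H1. \<bar>\<rho> u\<bar> \<le> C * H1_norm u)}"

definition ess_bounded :: "'a::euclidean_space L2 \<Rightarrow> bool"
  where "ess_bounded u \<longleftrightarrow> (\<exists>C. AE x in torus. \<bar>L2_fun u x\<bar> \<le> C)"

definition W2_inf :: "'a::euclidean_space L2 set"
  where "W2_inf = {u \<in> H2. ess_bounded u \<and>
    (\<forall>b\<in>Basis. ess_bounded (weak_deriv b u) \<and>
      (\<forall>c\<in>Basis. ess_bounded (weak_deriv c (weak_deriv b u))))}"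

definition laplacian :: "'a::euclidean_space L2 \<Rightarrow> 'a L2"
  where "laplacian u = (\<Sum>b\<in>Basis. weak_deriv b (weak_deriv b u))"


section \<open>The operator \<open>L = - \<nu> \<Delta> + lam Id\<close> and its inverse\<close>

text \<open>\<open>L\<close> as a map from \<open>H2\<close> to \<open>L2\<close>, and as a map from \<open>H1\<close> to its dual.\<close>

definition L_op :: "real \<Rightarrow> real \<Rightarrow> 'a::euclidean_space L2 \<Rightarrow> 'a L2"
  where "L_op \<nu> lam u = - (\<nu> *\<^sub>R laplacian u) + lam *\<^sub>R u"

definition L_dual :: "real \<Rightarrow> real \<Rightarrow> 'a::euclidean_space L2 \<Rightarrow> 'a L2 \<Rightarrow> real"
  where "L_dual \<nu> lam u \<phi> =
    \<nu> * (\<Sum>b\<in>Basis. inner (weak_deriv b u) (weak_deriv b \<phi>)) + lam * inner u \<phi>"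

definition L_inv :: "real \<Rightarrow> real \<Rightarrow> ('a::euclidean_space L2 \<Rightarrow> real) \<Rightarrow> 'a L2"
  where "L_inv \<nu> lam \<rho> = (THE w. w \<in> H1 \<and> (\<forall>\<phi>\<in>H1. L_dual \<nu> lam w \<phi> = \<rho> \<phi>))"


section \<open>Impulse operator, projection and the limit system\<close>

definition impulse :: "('a::euclidean_space \<Rightarrow> 'a \<Rightarrow> real) \<Rightarrow> 'a set \<Rightarrow> ('a \<Rightarrow> real) \<Rightarrow> 'a \<Rightarrow> real"
  where "impulse k J v x = (INF \<xi>\<in>J. k x \<xi> + v (x + \<xi>))"

definition le_impulse ::
    "('a::euclidean_space \<Rightarrow> 'a \<Rightarrow> real) \<Rightarrow> 'a set \<Rightarrow> 'a L2 \<Rightarrow> 'a L2 \<Rightarrow> bool"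
  where "le_impulse k J v u \<longleftrightarrow> (AE x in torus. L2_fun v x \<le> impulse k J (L2_fun u) x)"

text \<open>An element \<open>g\<close> of \<open>L2\<close> is identified with the functional \<open>inner g\<close> in the dual of \<open>H1\<close>.\<close>

definition K' :: "real \<Rightarrow> real \<Rightarrow> ('a::euclidean_space \<Rightarrow> 'a \<Rightarrow> real) \<Rightarrow> 'a set \<Rightarrow> 'a L2 set"
  where "K' \<nu> lam k J = {g. le_impulse k J (L_inv \<nu> lam (inner g)) (L_inv \<nu> lam (inner g))}"

text \<open>The library's \<open>closest_point\<close> is restricted to spaces with the Heine-Borel property.\<close>

definition proj :: "'a::real_inner set \<Rightarrow> 'a \<Rightarrow> 'a"
  where "proj A x = (THE p. p \<in> A \<and> (\<forall>y\<in>A. dist x p \<le> dist x y))"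

definition monotone_with :: "real \<Rightarrow> ('a::real_inner \<Rightarrow> 'a) \<Rightarrow> bool"
  where "monotone_with \<alpha> f \<longleftrightarrow> (\<forall>m m'. inner (f m - f m') (m - m') \<ge> \<alpha> * (norm (m - m'))\<^sup>2)"

definition mfg_solution ::
    "real \<Rightarrow> real \<Rightarrow> ('a::euclidean_space L2 \<Rightarrow> real) \<Rightarrow> ('a L2 \<Rightarrow> 'a L2) \<Rightarrow>
      ('a \<Rightarrow> 'a \<Rightarrow> real) \<Rightarrow> 'a set \<Rightarrow> 'a L2 \<Rightarrow> 'a L2 \<Rightarrow> bool"
  where "mfg_solution \<nu> lam \<rho> f k J u m \<longleftrightarrow>
    u \<in> H2 \<and> m \<in> H1 \<and>
    (\<forall>v\<in>H1. le_impulse k J v u \<longrightarrow>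
      inner (f m + \<nu> *\<^sub>R laplacian u - lam *\<^sub>R u) (v - u) \<le> 0) \<and>
    (\<forall>v\<in>H1. le_impulse k J v v \<longrightarrow>
      L_dual \<nu> lam m (v - u) - \<rho> (v - u) \<ge> 0) \<and>
    inner (f m + \<nu> *\<^sub>R laplacian u - lam *\<^sub>R u) m = 0 \<and>
    le_impulse k J u u \<and> nonneg m"

end

theory Submission
  imports Defs
begin

text \<open>
  The iteration is Uzawa's algorithm, a projected gradient method, in the variables \<open>g\<^sub>n = L u\<^sub>n\<close> and
  \<open>m\<^sub>n\<close>. Write \<open>g = L u\<close> for the solution \<open>(u, m)\<close>. In the first variational inequality, the competitors
  \<open>u - \<phi>\<close> with \<open>\<phi> \<ge> 0\<close> show that \<open>f(m) - g \<ge> 0\<close> (\<open>mfg_solution_nonneg\<close>). Together with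
  \<open>\<integral> (f(m) - g) m = 0\<close> and the inequality defining \<open>m\<^sub>n\<close>, monotonicity of \<open>f\<close> gives

  \<open>\<alpha> \<parallel>m\<^sub>n - m\<parallel>\<^sup>2 \<le> \<integral> (g\<^sub>n - g) (m\<^sub>n - m)\<close>.

  The second variational inequality says that \<open>g\<close> is a fixed point of the projected step
  (\<open>mfg_solution_dual\<close>). The projection onto the closed convex set \<open>K'\<close> is nonexpansive, so
  (\<open>Uzawa_step\<close>)

  \<open>\<parallel>g\<^sub>n\<^sub>+\<^sub>1 - g\<parallel>\<^sup>2 \<le> \<parallel>g\<^sub>n - g - \<delta> (m\<^sub>n - m)\<parallel>\<^sup>2 \<le> \<parallel>g\<^sub>n - g\<parallel>\<^sup>2 - \<delta> (2 \<alpha> - \<delta>) \<parallel>m\<^sub>n - m\<parallel>\<^sup>2\<close>.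

  As \<open>\<delta> < 2 \<alpha>\<close>, summing over \<open>n\<close> shows that \<open>\<Sum> \<parallel>m\<^sub>n - m\<parallel>\<^sup>2\<close> converges, hence \<open>m\<^sub>n\<close> tends to \<open>m\<close>.

  The remaining work is to show that the objects involved are well defined. The projection exists
  because \<open>L2\<close> is complete and \<open>K'\<close> is closed and convex. The inverse of \<open>L\<close> exists on the dual of \<open>H1\<close> by
  the Riesz representation theorem, applied to the graph of the gradient (\<open>L_inv_exists\<close>). That it agrees on
  \<open>H2\<close> with \<open>L\<close> defined by weak derivatives (\<open>L_inv_L_op\<close>), the uniqueness of weak derivatives, and the
  test for nonnegativity all rest on one fact: indicators of Borel sets are \<open>L1\<close> limits of trigonometric
  polynomials with values in \<open>[0, 1]\<close> (\<open>trig_approx_borel\<close>).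
\<close>

section \<open>The torus: periodicity, null sets and translations\<close>

lemma space_torus [simp]: "space torus = cbox 0 (One :: 'a::euclidean_space)"
  by (simp add: torus_def space_restrict_space)

lemma emeasure_torus: "emeasure torus (space torus :: 'a::euclidean_space set) = 1"
  unfolding space_torus torus_def
  by (simp add: emeasure_restrict_space emeasure_lborel_cbox_eq)

interpretation torus: finite_measure "torus :: 'a::euclidean_space measure"
  by standard (use emeasure_torus[where 'a='a] in auto)

lemma measure_torus_space [simp]: "measure torus (cbox 0 (One :: 'a::euclidean_space)) = 1"
  using emeasure_torus[where 'a='a] by (simp add: measure_def)

lemma AE_torus_iff: "(AE x in torus. P x) \<longleftrightarrow> (AE x in lborel. x \<in> cbox 0 One \<longrightarrow> P x)"
  unfolding torus_def by (rule AE_restrict_space_iff) simp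

text \<open>
  The predicate \<open>P\<close> need not be measurable: almost-everywhere statements only depend on the
  null sets of the completion.
\<close>

lemma AE_lborel_iff_negligible: "(AE x in lborel. P x) \<longleftrightarrow> negligible {x. \<not> P x}"
  unfolding negligible_iff_null_sets
  by (subst AE_completion_iff[symmetric], subst completion.AE_iff_null_sets) auto

text \<open>
  The period lattice. It also serves as the set of frequencies of the trigonometric polynomials
  below, because it is its own dual.
\<close>

definition lattice :: "'a::euclidean_space set"
  where "lattice = {z. \<forall>b\<in>Basis. z \<bullet> b \<in> \<int>}"

lemma countable_lattice: "countable (lattice :: 'a::euclidean_space set)"
proof -
  have "lattice \<subseteq> (\<lambda>h. \<Sum>b\<in>Basis. of_int (h b) *\<^sub>R b) ` (PiE (Basis::'a set) (\<lambda>_. UNIV :: int set))"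
  proof
    fix z :: 'a assume z: "z \<in> lattice"
    have "z = (\<Sum>b\<in>Basis. of_int (restrict (\<lambda>b. \<lfloor>z \<bullet> b\<rfloor>) Basis b) *\<^sub>R b)"
      by (subst euclidean_representation[of z, symmetric], rule sum.cong)
        (use z in \<open>auto simp: lattice_def elim!: Ints_cases\<close>)
    moreover have "restrict (\<lambda>b. \<lfloor>z \<bullet> b\<rfloor>) Basis \<in> PiE (Basis::'a set) (\<lambda>_. UNIV :: int set)"
      by simp
    ultimately show "z \<in> (\<lambda>h. \<Sum>b\<in>Basis. of_int (h b) *\<^sub>R b) ` (PiE (Basis::'a set) (\<lambda>_. UNIV :: int set))"
      by (rule image_eqI)
  qed
  then show ?thesis
    by (rule countable_subset) (intro countable_image countable_PiE, auto)
qed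

lemma periodic_int:
  assumes "periodic f" "b \<in> Basis"
  shows "f (x + of_int n *\<^sub>R b) = f x"
proof -
  have *: "f (x + real k *\<^sub>R b) = f x" for k :: nat and x
  proof (induction k)
    case (Suc k)
    have "f (x + real (Suc k) *\<^sub>R b) = f ((x + real k *\<^sub>R b) + b)"
      by (simp add: algebra_simps)
    also have "\<dots> = f x" using assms Suc by (simp only: periodic_def)
    finally show ?case .
  qed simp
  show ?thesis
  proof (cases "n \<ge> 0")
    case True then show ?thesis using *[of x "nat n"] by simp
  next
    case False
    then show ?thesis using *[of "x + of_int n *\<^sub>R b" "nat (- n)"] by (simp add: algebra_simps)
  qed
qed

lemma periodic_lattice:
  fixes f :: "'a::euclidean_space \<Rightarrow> 'b"
  assumes f: "periodic f" and z: "z \<in> lattice"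
  shows "f (x + z) = f x"
proof -
  have "f (x + (\<Sum>b\<in>B. of_int \<lfloor>z \<bullet> b\<rfloor> *\<^sub>R b)) = f x" if "finite B" "B \<subseteq> Basis" for B
    using that
  proof (induction B)
    case (insert b B)
    then show ?case
      using periodic_int[OF f, of b "x + (\<Sum>b\<in>B. of_int \<lfloor>z \<bullet> b\<rfloor> *\<^sub>R b)"]
      by (simp add: add.commute add.left_commute)
  qed simp
  from this[OF finite_Basis order_refl]
  have "f (x + (\<Sum>b\<in>Basis. of_int \<lfloor>z \<bullet> b\<rfloor> *\<^sub>R b)) = f x" .
  moreover have "(\<Sum>b\<in>Basis. of_int \<lfloor>z \<bullet> b\<rfloor> *\<^sub>R b) = z"
    by (subst (2) euclidean_representation[of z, symmetric], rule sum.cong)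
      (use z in \<open>auto simp: lattice_def elim!: Ints_cases\<close>)
  ultimately show ?thesis by simp
qed

text \<open>
  The exceptional set in the whole space is covered by the countably many lattice translates of
  the exceptional set in the cube. This makes almost-everywhere statements about periodic
  predicates stable under arbitrary translations, which is what the shifts in the impulse
  operator require.
\<close>

lemma AE_torus_imp_lborel:
  fixes P :: "'a::euclidean_space \<Rightarrow> bool"
  assumes "AE x in torus. P x" "periodic P"
  shows "AE x in lborel. P x"
proof -
  let ?N = "{x \<in> cbox 0 One. \<not> P x}"
  have N: "negligible ?N"
    using assms(1) unfolding AE_torus_iff AE_lborel_iff_negligible
    by (rule negligible_subset) auto
  have "{x. \<not> P x} \<subseteq> (\<Union>z\<in>lattice. (+) z ` ?N)"
  proof
    fix x assume "x \<in> {x. \<not> P x}"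
    define z where "z = (\<Sum>b\<in>Basis. of_int \<lfloor>x \<bullet> b\<rfloor> *\<^sub>R b)"
    have zb: "z \<bullet> b = of_int \<lfloor>x \<bullet> b\<rfloor>" if "b \<in> Basis" for b
      using that by (simp add: z_def)
    have z: "z \<in> lattice" by (simp add: lattice_def zb)
    have "x - z \<in> cbox 0 One"
      by (auto simp: mem_box zb inner_diff_left) linarith
    moreover have "\<not> P (x - z)"
      using periodic_lattice[OF assms(2) z, of "x - z"] \<open>x \<in> _\<close> by simp
    ultimately have "x \<in> (+) z ` ?N" by (intro image_eqI[of _ _ "x - z"]) auto
    then show "x \<in> (\<Union>z\<in>lattice. (+) z ` ?N)" using z by blast
  qed
  moreover have "negligible (\<Union>z\<in>lattice. (+) z ` ?N)"
    by (intro negligible_countable_Union countable_image countable_lattice)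
      (auto intro: negligible_translation N)
  ultimately show ?thesis
    unfolding AE_lborel_iff_negligible by (rule negligible_subset[rotated])
qed

lemma AE_lborel_shift:
  fixes P :: "'a::euclidean_space \<Rightarrow> bool"
  assumes "AE x in lborel. P x"
  shows "AE x in lborel. P (x + \<xi>)"
proof -
  have "{x. \<not> P (x + \<xi>)} = (+) (- \<xi>) ` {x. \<not> P x}"
    by (auto simp: image_iff intro!: exI[of _ "_ + \<xi>"])
  then show ?thesis
    using negligible_translation assms unfolding AE_lborel_iff_negligible by metis
qed

lemma AE_torus_shift:
  fixes P :: "'a::euclidean_space \<Rightarrow> bool"
  assumes "AE x in torus. P x" "periodic P"
  shows "AE x in torus. P (x + \<xi>)"
  using AE_lborel_shift[OF AE_torus_imp_lborel[OF assms], of \<xi>] unfolding AE_torus_iff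
  by eventually_elim simp

lemma integral_torus: "integral\<^sup>L torus f = (\<integral>x. indicator (cbox 0 One) x * f x \<partial>lborel)" for f :: "_ \<Rightarrow> real"
  unfolding torus_def by (subst integral_restrict_space) auto

lemma lborel_plus: "distr lborel borel (\<lambda>x. x + c) = lborel"
  using lborel_distr_plus[of c] by (simp add: add.commute[of _ c])

lemma integral_lborel_shift:
  fixes f :: "'a::euclidean_space \<Rightarrow> real"
  assumes [measurable]: "f \<in> borel_measurable borel"
  shows "(\<integral>x. f (x + c) \<partial>lborel) = (\<integral>x. f x \<partial>lborel)"
  by (subst (2) lborel_plus[of c, symmetric]) (simp add: integral_distr)

text \<open>
  After a shift by \<open>t\<close> in direction \<open>b\<close> the cube splits into the slab \<open>U\<close>, which stays in the
  original cube, and the slab \<open>W\<close>, which a shift by one period \<open>b\<close> carries to the missing slab \<open>V\<close>.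
\<close>

lemma integral_torus_shift:
  fixes f :: "'a::euclidean_space \<Rightarrow> real"
  assumes f: "periodic f" "continuous_on UNIV f" and b: "b \<in> Basis" and t: "0 \<le> t" "t \<le> 1"
  shows "(\<integral>x. f (x + t *\<^sub>R b) \<partial>torus) = (\<integral>x. f x \<partial>torus)"
proof -
  have [measurable]: "f \<in> borel_measurable borel" using f by (rule_tac borel_measurable_continuous_onI)
  define C where "C = (cbox 0 One :: 'a set)"
  have [measurable]: "C \<in> sets borel" by (simp add: C_def)
  \<comment> \<open>The strict and weak inequalities make the splitting of the shifted cube exact; the original
    cube is then the union of the two slabs up to two hyperplanes.\<close>
  define U where "U = {x\<in>C. t \<le> x \<bullet> b}"
  define V where "V = {x\<in>C. 0 < x \<bullet> b \<and> x \<bullet> b \<le> t}"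
  define W where "W = (\<lambda>x. x - b) -` V"
  have [measurable]: "U \<in> sets borel" "V \<in> sets borel"
    unfolding U_def V_def by measurable
  have [measurable]: "W \<in> sets borel"
    unfolding W_def using measurable_sets[of "\<lambda>x. x - b" borel borel V] by simp
  have b1: "b \<bullet> c = (if c = b then 1 else 0)" if "c \<in> Basis" for c
    using b that by (simp add: inner_Basis)
  have bdd: "integrable lborel (\<lambda>x. indicator A x * f x)" if [measurable]: "A \<in> sets borel" and "A \<subseteq> cbox 0 (One+One)" for A
  proof -
    obtain K where K: "\<And>x. x \<in> cbox 0 (One+One) \<Longrightarrow> norm (f x) \<le> K"
      using compact_continuous_image[OF continuous_on_subset[OF f(2)], of "cbox 0 (One+One)"]
      by (metis bounded_iff compact_cbox compact_imp_bounded image_eqI subset_UNIV)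
    show ?thesis
    proof (rule Bochner_Integration.integrable_bound)
      show "integrable lborel (\<lambda>x. indicator (cbox 0 (One+One)) x * K :: real)"
        by (intro integrable_mult_left integrable_real_indicator) (auto simp: emeasure_lborel_cbox_eq)
      show "AE x in lborel. norm (indicator A x * f x) \<le> norm (indicator (cbox 0 (One+One)) x * K)"
        using K \<open>A \<subseteq> _\<close> by (intro AE_I2) (fastforce simp: indicator_def intro: order_trans)
    qed measurable
  qed
  have "(\<integral>x. f (x + t *\<^sub>R b) \<partial>torus) = (\<integral>x. indicator C ((x + t *\<^sub>R b) - t *\<^sub>R b) * f (x + t *\<^sub>R b) \<partial>lborel)"
    by (simp add: integral_torus C_def)
  also have "\<dots> = (\<integral>x. indicator C (x - t *\<^sub>R b) * f x \<partial>lborel)"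
    by (rule integral_lborel_shift) measurable
  also have "\<dots> = (\<integral>x. indicator U x * f x + indicator W x * f x \<partial>lborel)"
  proof (rule Bochner_Integration.integral_cong[OF refl])
    fix x
    have "indicator C (x - t *\<^sub>R b) = (indicator U x + indicator W x :: real)"
    proof -
      have "x - t *\<^sub>R b \<in> C \<longleftrightarrow> x \<in> U \<or> x \<in> W"
        using b t by (fastforce simp: C_def U_def V_def W_def mem_box inner_diff_left b1 split: if_splits)
      moreover have "\<not> (x \<in> U \<and> x \<in> W)"
        using b by (force simp: C_def U_def V_def W_def mem_box inner_diff_left)
      ultimately show ?thesis by (auto simp: indicator_def)
    qed
    then show "indicator C (x - t *\<^sub>R b) * f x = indicator U x * f x + indicator W x * f x"
      by (simp add: distrib_right)
  qed
  also have "\<dots> = (\<integral>x. indicator U x * f x \<partial>lborel) + (\<integral>x. indicator W x * f x \<partial>lborel)"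
    by (intro Bochner_Integration.integral_add bdd; measurable?)
      (use b t in \<open>fastforce simp: C_def U_def V_def W_def mem_box inner_diff_left b1 algebra_simps split: if_splits\<close>)+
  also have "(\<integral>x. indicator W x * f x \<partial>lborel) = (\<integral>x. indicator W (x + b) * f (x + b) \<partial>lborel)"
    by (rule integral_lborel_shift[symmetric]) measurable
  also have "\<dots> = (\<integral>x. indicator V x * f x \<partial>lborel)"
    using f(1) b by (intro Bochner_Integration.integral_cong) (auto simp: W_def periodic_def indicator_def)
  also have "(\<integral>x. indicator U x * f x \<partial>lborel) + \<dots> = (\<integral>x. indicator U x * f x + indicator V x * f x \<partial>lborel)"
    by (intro Bochner_Integration.integral_add[symmetric] bdd; measurable?)
      (force simp: C_def U_def V_def mem_box inner_add_left)+
  also have "\<dots> = (\<integral>x. indicator C x * f x \<partial>lborel)"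
  proof (rule integral_cong_AE)
    have "AE x in lborel. x \<bullet> b \<noteq> t" "AE x in lborel. x \<bullet> b \<noteq> 0"
      unfolding AE_lborel_iff_negligible
      using negligible_standard_hyperplane[OF b, of t] negligible_standard_hyperplane[OF b, of 0] by simp_all
    then show "AE x in lborel. indicator U x * f x + indicator V x * f x = indicator C x * f x"
    proof eventually_elim
      case (elim x)
      have "0 \<le> x \<bullet> b" if "x \<in> C" using that b by (auto simp: C_def mem_box)
      then have "(indicator U x + indicator V x :: real) = indicator C x"
        using elim by (auto simp: U_def V_def indicator_def)
      then show ?case by (metis distrib_right)
    qed
  qed measurable
  also have "\<dots> = (\<integral>x. f x \<partial>torus)" by (simp add: integral_torus C_def)
  finally show ?thesis .
qed

section \<open>Completeness of the space of square integrable functions\<close>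

lemma L2_rel_refl: "L2_rel f f \<longleftrightarrow> sq_int f"
  by (simp add: L2_rel_def)

lemma sq_int_L2_fun [simp]: "sq_int (L2_fun u)"
  using Quotient_rep_reflp[OF Quotient_L2, of u] by (simp add: L2_rel_refl)

lemma periodic_L2_fun: "periodic (L2_fun u)"
  using sq_int_L2_fun[of u] by (simp add: sq_int_def)

lemma borel_L2_fun [measurable]: "L2_fun u \<in> borel_measurable borel"
  using sq_int_L2_fun[of u] by (simp add: sq_int_def)

lemma borel_torus_L2_fun [measurable]: "L2_fun u \<in> borel_measurable torus"
  by (rule borel_measurable_torus) measurable

lemma abs_L2_fun [simp]: "abs_L2 (L2_fun u) = u"
  by (rule Quotient_abs_rep[OF Quotient_L2])

lemma L2_fun_abs: "sq_int f \<Longrightarrow> AE x in torus. L2_fun (abs_L2 f) x = f x"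
  using Quotient_rep_abs[OF Quotient_L2, of f] by (simp add: L2_rel_def)

lemma L2_eqI: 
  assumes "AE x in torus. L2_fun u x = L2_fun v x" 
  shows "u = v"
proof -
  have "abs_L2 (L2_fun u) = abs_L2 (L2_fun v)"
    using assms by (intro Quotient_rel_abs[OF Quotient_L2]) (simp add: L2_rel_def)
  then show ?thesis by simp
qed

lemma L2_fun_add: "AE x in torus. L2_fun (u + v) x = L2_fun u x + L2_fun v x"
proof -
  have "u + v = abs_L2 (\<lambda>x. L2_fun u x + L2_fun v x)"
    using plus_L2.abs_eq[of "L2_fun u" "L2_fun v"] by (simp add: L2_rel_refl)
  then show ?thesis using L2_fun_abs[OF sq_int_add[of "L2_fun u" "L2_fun v"]] by simp
qed

lemma L2_fun_scaleR: "AE x in torus. L2_fun (c *\<^sub>R u) x = c * L2_fun u x"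
proof -
  have "c *\<^sub>R u = abs_L2 (\<lambda>x. c * L2_fun u x)"
    using scaleR_L2.abs_eq[of "L2_fun u" c] by (simp add: L2_rel_refl)
  then show ?thesis using L2_fun_abs[OF sq_int_cmult[of "L2_fun u" c]] by simp
qed

lemma L2_fun_diff: "AE x in torus. L2_fun (u - v) x = L2_fun u x - L2_fun v x"
proof -
  have "u - v = u + (-1) *\<^sub>R v" by simp
  then show ?thesis
    using L2_fun_add[of u "(-1) *\<^sub>R v"] L2_fun_scaleR[of "-1" v]
    by (auto elim: eventually_elim2)
qed

lemma inner_L2_eq: "inner u v = (\<integral>x. L2_fun u x * L2_fun v x \<partial>torus)"
  by (simp add: inner_L2_def)

lemma inner_abs_L2:
  assumes "sq_int g" 
  shows "inner u (abs_L2 g) = (\<integral>x. L2_fun u x * g x \<partial>torus)"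
  unfolding inner_L2_eq
proof (rule integral_cong_AE)
  show "AE x in torus. L2_fun u x * L2_fun (abs_L2 g) x = L2_fun u x * g x"
    using L2_fun_abs[OF assms] by eventually_elim simp
qed (use sq_int_borel_torus[OF assms] in measurable)

lemma norm_L2_square: "(norm u)\<^sup>2 = (\<integral>x. (L2_fun u x)\<^sup>2 \<partial>torus)"
  unfolding power2_norm_eq_inner inner_L2_eq by (simp add: power2_eq_square)

lemma sq_int_const [simp]: "sq_int (\<lambda>_. c)"
  by (simp add: sq_int_def periodic_def)

lemma sq_int_integrable: "sq_int f \<Longrightarrow> integrable torus f"
  using sq_int_mult_integrable[of f "\<lambda>_. 1"] by simp

lemma norm_abs_L2: "sq_int g \<Longrightarrow> (norm (abs_L2 g))\<^sup>2 = (\<integral>x. (g x)\<^sup>2 \<partial>torus)"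
  unfolding norm_L2_square
proof (rule integral_cong_AE)
  assume g: "sq_int g"
  then have [measurable]: "g \<in> borel_measurable torus" by (rule sq_int_borel_torus)
  show "(\<lambda>x. (g x)\<^sup>2) \<in> borel_measurable torus" by measurable
  show "AE x in torus. (L2_fun (abs_L2 g) x)\<^sup>2 = (g x)\<^sup>2"
    using L2_fun_abs[OF g] by eventually_elim simp
qed measurable

lemma sq_int_abs: "sq_int f \<Longrightarrow> sq_int (\<lambda>x. \<bar>f x\<bar>)"
  by (auto simp: sq_int_def periodic_def)

lemma integral_abs_le_norm:
  fixes u :: "'a::euclidean_space L2"
  shows "(\<integral>x. \<bar>L2_fun u x\<bar> \<partial>torus) \<le> norm u"
proof -
  let ?v = "abs_L2 (\<lambda>x. \<bar>L2_fun u x\<bar>)" and ?one = "abs_L2 (\<lambda>_. 1) :: 'a L2"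
  have "(\<integral>x. \<bar>L2_fun u x\<bar> \<partial>torus) = (\<integral>x. L2_fun ?v x * 1 \<partial>torus)"
    by (rule integral_cong_AE)
      (use L2_fun_abs[OF sq_int_abs[OF sq_int_L2_fun[of u]]] in \<open>auto elim: eventually_mono\<close>)
  also have "\<dots> = inner ?v ?one" by (simp add: inner_abs_L2)
  also have "\<dots> \<le> norm ?v * norm ?one" by (rule norm_cauchy_schwarz)
  also have "norm ?v = norm u"
    by (rule power2_eq_imp_eq) (subst norm_abs_L2, simp_all add: sq_int_abs norm_L2_square)
  also have "norm ?one = 1"
    by (rule power2_eq_imp_eq) (simp_all add: norm_abs_L2)
  finally show ?thesis by simp
qed

lemma integral_abs_diff_le: "(\<integral>x. \<bar>L2_fun u x - L2_fun v x\<bar> \<partial>torus) \<le> norm (u - v)"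
proof -
  have "(\<integral>x. \<bar>L2_fun u x - L2_fun v x\<bar> \<partial>torus) = (\<integral>x. \<bar>L2_fun (u - v) x\<bar> \<partial>torus)"
    by (rule integral_cong_AE) (use L2_fun_diff[of u v] in \<open>auto elim: eventually_mono\<close>)
  then show ?thesis using integral_abs_le_norm[of "u - v"] by simp
qed

lemma integrable_L2_fun [simp]: "integrable torus (L2_fun u)"
  by (simp add: sq_int_integrable)

lemma L2_tendsto_AE_subseq:
  assumes "X \<longlonglongrightarrow> u"
  shows "\<exists>r::nat\<Rightarrow>nat. strict_mono r \<and> (AE x in torus. (\<lambda>n. L2_fun (X (r n)) x) \<longlonglongrightarrow> L2_fun u x)"
proof -
  have "(\<lambda>n. norm (X n - u)) \<longlonglongrightarrow> 0"
    using assms by (simp add: LIM_zero tendsto_norm_zero)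
  then have lim: "(\<lambda>n. \<integral>x. norm (L2_fun (X n) x - L2_fun u x) \<partial>torus) \<longlonglongrightarrow> 0"
    by (rule tendsto_sandwich[OF _ _ tendsto_const, rotated 2])
      (simp_all add: integral_abs_diff_le)
  have "integrable torus (\<lambda>x. L2_fun (X n) x - L2_fun u x)" for n
    by (intro Bochner_Integration.integrable_diff integrable_L2_fun)
  from tendsto_L1_AE_subseq[OF this lim] show ?thesis
    unfolding LIM_zero_iff .
qed

text \<open>
  The index sequence need not be strictly increasing; it only has to tend to infinity.
\<close>

lemma Cauchy_fast_subseq:
  fixes X :: "nat \<Rightarrow> 'a::metric_space"
  assumes "Cauchy X"
  obtains r :: "nat \<Rightarrow> nat" where "\<And>n. n \<le> r n" "\<And>n. dist (X (r (Suc n))) (X (r n)) \<le> (1/2)^n"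
proof -
  have "\<forall>n. \<exists>N. \<forall>i\<ge>N. \<forall>j\<ge>N. dist (X i) (X j) < (1/2)^n"
    using assms unfolding Cauchy_def by simp
  then obtain N where N: "\<And>n i j. i \<ge> N n \<Longrightarrow> j \<ge> N n \<Longrightarrow> dist (X i) (X j) < (1/2)^n"
    by metis
  define r where "r n = n + (\<Sum>k\<le>n. N k)" for n
  have "N n \<le> r n" "N n \<le> r (Suc n)" for n
    using member_le_sum[of n "{..n}" N] by (simp_all add: r_def)
  then show ?thesis by (intro that[of r] less_imp_le[OF N]) (simp_all add: r_def)
qed

text \<open>
  Riesz--Fischer: along a rapidly converging subsequence the increments have summable integrals, so
  the representatives converge almost everywhere, and Fatou's lemma shows that the pointwise limit is
  the limit in the norm. The limit function \<open>g\<close> is defined by \<open>lim\<close> at every point, which makes it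
  periodic on the whole space and not only up to a null set.
\<close>

instance L2 :: (euclidean_space) complete_space
proof
  fix X :: "nat \<Rightarrow> 'a L2" assume X: "Cauchy X"
  obtain r :: "nat \<Rightarrow> nat" where r: "\<And>n. n \<le> r n" "\<And>n. dist (X (r (Suc n))) (X (r n)) \<le> (1/2)^n"
    using Cauchy_fast_subseq[OF X] by blast
  define F where "F n = L2_fun (X (r n))" for n
  have [measurable]: "F n \<in> borel_measurable borel" "F n \<in> borel_measurable torus" for n
    unfolding F_def by measurable
  define d where "d n x = F (Suc n) x - F n x" for n x
  have [measurable]: "d n \<in> borel_measurable torus" for n unfolding d_def by measurable
  have "AE x in torus. (\<Sum>n. ennreal \<bar>d n x\<bar>) \<noteq> \<infinity>"
  proof (rule nn_integral_noteq_infinite)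
    have "(\<integral>\<^sup>+x. (\<Sum>n. ennreal \<bar>d n x\<bar>) \<partial>torus) = (\<Sum>n. \<integral>\<^sup>+x. ennreal \<bar>d n x\<bar> \<partial>torus)"
      by (rule nn_integral_suminf) measurable
    also have "\<dots> \<le> (\<Sum>n. ennreal ((1/2)^n))"
    proof (rule suminf_le)
      fix n
      have "(\<integral>\<^sup>+x. ennreal \<bar>d n x\<bar> \<partial>torus) = ennreal (\<integral>x. \<bar>d n x\<bar> \<partial>torus)"
        by (rule nn_integral_eq_integral) (simp_all add: d_def F_def)
      also have "\<dots> \<le> ennreal ((1/2)^n)"
        unfolding d_def F_def using r(2)[of n]
        by (intro ennreal_leI order_trans[OF integral_abs_diff_le]) (simp add: dist_norm)
      finally show "(\<integral>\<^sup>+x. ennreal \<bar>d n x\<bar> \<partial>torus) \<le> ennreal ((1/2)^n)" .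
    qed auto
    also have "\<dots> = ennreal (\<Sum>n. (1/2)^n)" by (rule suminf_ennreal2) (auto intro: summable_geometric)
    also have "\<dots> < \<infinity>" by simp
    finally show "(\<integral>\<^sup>+x. (\<Sum>n. ennreal \<bar>d n x\<bar>) \<partial>torus) \<noteq> \<infinity>" by simp
  qed measurable
  then have conv: "AE x in torus. (\<lambda>n. F n x) \<longlonglongrightarrow> lim (\<lambda>n. F n x)"
  proof eventually_elim
    case (elim x)
    have "summable (\<lambda>n. \<bar>d n x\<bar>)"
      using elim by (intro summable_suminf_not_top) auto
    then have "summable (\<lambda>n. d n x)" by (rule summable_rabs_cancel)
    then have "(\<lambda>n. \<Sum>i<n. d i x) \<longlonglongrightarrow> (\<Sum>i. d i x)" by (rule summable_LIMSEQ)
    moreover have "(\<Sum>i<n. d i x) = F n x - F 0 x" for n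
      unfolding d_def by (rule sum_lessThan_telescope)
    ultimately have "(\<lambda>n. F n x - F 0 x + F 0 x) \<longlonglongrightarrow> (\<Sum>i. d i x) + F 0 x"
      by (intro tendsto_add) auto
    then show ?case by (simp add: limI)
  qed
  define g where "g x = lim (\<lambda>n. F n x)" for x
  have [measurable]: "g \<in> borel_measurable borel" unfolding g_def by measurable
  then have [measurable]: "g \<in> borel_measurable torus" by (rule borel_measurable_torus)
  have per: "periodic g"
    unfolding periodic_def g_def F_def
  proof (intro allI ballI)
    fix x b :: 'a assume "b \<in> Basis"
    then have "L2_fun (X (r n)) (x + b) = L2_fun (X (r n)) x" for n
      using periodic_L2_fun[of "X (r n)"] by (simp add: periodic_def)
    then show "lim (\<lambda>n. L2_fun (X (r n)) (x + b)) = lim (\<lambda>n. L2_fun (X (r n)) x)" by simp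
  qed
  have key: "(\<integral>\<^sup>+x. ennreal ((L2_fun (X i) x - g x)\<^sup>2) \<partial>torus) \<le> ennreal (e\<^sup>2)"
    if e: "e > 0" and N: "\<And>i j. i \<ge> N \<Longrightarrow> j \<ge> N \<Longrightarrow> dist (X i) (X j) < e" and i: "i \<ge> N" for e N i
  proof -
    have "(\<integral>\<^sup>+x. ennreal ((L2_fun (X i) x - g x)\<^sup>2) \<partial>torus)
        = (\<integral>\<^sup>+x. liminf (\<lambda>n. ennreal ((L2_fun (X i) x - F n x)\<^sup>2)) \<partial>torus)"
    proof (rule nn_integral_cong_AE)
      show "AE x in torus. ennreal ((L2_fun (X i) x - g x)\<^sup>2) = liminf (\<lambda>n. ennreal ((L2_fun (X i) x - F n x)\<^sup>2))"
        using conv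
      proof eventually_elim
        case (elim x)
        then have "(\<lambda>n. ennreal ((L2_fun (X i) x - F n x)\<^sup>2)) \<longlonglongrightarrow> ennreal ((L2_fun (X i) x - g x)\<^sup>2)"
          unfolding g_def by (intro tendsto_intros)
        then show ?case by (intro lim_imp_Liminf[symmetric] trivial_limit_sequentially)
      qed
    qed
    also have "\<dots> \<le> liminf (\<lambda>n. \<integral>\<^sup>+x. ennreal ((L2_fun (X i) x - F n x)\<^sup>2) \<partial>torus)"
      by (rule nn_integral_liminf) measurable
    also have "\<dots> \<le> limsup (\<lambda>n. \<integral>\<^sup>+x. ennreal ((L2_fun (X i) x - F n x)\<^sup>2) \<partial>torus)"
      by (rule Liminf_le_Limsup) simp
    also have "\<dots> \<le> ennreal (e\<^sup>2)"
    proof (rule Limsup_bounded, rule eventually_sequentiallyI[of N])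
      fix n assume n: "N \<le> n"
      have "(\<integral>\<^sup>+x. ennreal ((L2_fun (X i) x - F n x)\<^sup>2) \<partial>torus)
          = (\<integral>\<^sup>+x. ennreal ((L2_fun (X i - X (r n)) x)\<^sup>2) \<partial>torus)"
        by (rule nn_integral_cong_AE)
          (use L2_fun_diff[of "X i" "X (r n)"] in \<open>auto simp: F_def elim: eventually_mono\<close>)
      also have "\<dots> = ennreal ((norm (X i - X (r n)))\<^sup>2)"
        unfolding norm_L2_square
        by (rule nn_integral_eq_integral) (use sq_int_L2_fun in \<open>auto simp: sq_int_def\<close>)
      also have "\<dots> \<le> ennreal (e\<^sup>2)"
        using N[OF i order_trans[OF n r(1)]]
        by (intro ennreal_leI power_mono) (auto simp: dist_norm)
      finally show "(\<integral>\<^sup>+x. ennreal ((L2_fun (X i) x - F n x)\<^sup>2) \<partial>torus) \<le> ennreal (e\<^sup>2)" .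
    qed
    finally show ?thesis .
  qed
  have sq: "sq_int (\<lambda>x. L2_fun (X i) x - g x)" 
    and le: "(\<integral>x. (L2_fun (X i) x - g x)\<^sup>2 \<partial>torus) \<le> e\<^sup>2"
    if "e > 0" and "\<And>i j. i \<ge> N \<Longrightarrow> j \<ge> N \<Longrightarrow> dist (X i) (X j) < e" and "i \<ge> N" for e N i
  proof -
    have k: "(\<integral>\<^sup>+x. ennreal ((L2_fun (X i) x - g x)\<^sup>2) \<partial>torus) \<le> ennreal (e\<^sup>2)" 
      by (rule key[OF that])
    have int: "integrable torus (\<lambda>x. (L2_fun (X i) x - g x)\<^sup>2)"
      by (rule integrableI_bounded) (use k in \<open>auto intro: le_less_trans\<close>)
    then show "sq_int (\<lambda>x. L2_fun (X i) x - g x)"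
      using per periodic_L2_fun[of "X i"] by (auto simp: sq_int_def periodic_def)
    show "(\<integral>x. (L2_fun (X i) x - g x)\<^sup>2 \<partial>torus) \<le> e\<^sup>2"
      using k by (subst (asm) nn_integral_eq_integral[OF int]) auto
  qed
  have cau: "\<exists>N. \<forall>i\<ge>N. \<forall>j\<ge>N. dist (X i) (X j) < e" if "e > 0" for e
    using X that unfolding Cauchy_def by auto
  have g: "sq_int g"
  proof -
    obtain N where "\<forall>i\<ge>N. \<forall>j\<ge>N. dist (X i) (X j) < 1" using cau[of 1] by auto
    then have "sq_int (\<lambda>x. L2_fun (X N) x + (-1) * (L2_fun (X N) x - g x))"
      by (intro sq_int_add sq_int_cmult sq[of 1 N]) auto
    then show ?thesis by simp
  qed
  have "X \<longlonglongrightarrow> abs_L2 g"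
  proof (rule LIMSEQ_I)
    fix e :: real assume "e > 0"
    then obtain N where N: "\<forall>i\<ge>N. \<forall>j\<ge>N. dist (X i) (X j) < e/2" using cau[of "e/2"] by auto
    have "norm (X i - abs_L2 g) < e" if i: "i \<ge> N" for i
    proof -
      have "(norm (X i - abs_L2 g))\<^sup>2 = (\<integral>x. (L2_fun (X i) x - g x)\<^sup>2 \<partial>torus)"
        unfolding norm_L2_square
      proof (rule integral_cong_AE)
        show "AE x in torus. (L2_fun (X i - abs_L2 g) x)\<^sup>2 = (L2_fun (X i) x - g x)\<^sup>2"
          using L2_fun_diff[of "X i" "abs_L2 g"] L2_fun_abs[OF g] by eventually_elim simp
      qed measurable
      also have "\<dots> \<le> (e/2)\<^sup>2"
        by (rule le[of "e/2" N]) (use N i \<open>e > 0\<close> in auto)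
      finally have "norm (X i - abs_L2 g) \<le> e/2"
        using \<open>e > 0\<close> by - (rule power2_le_imp_le, auto)
      then show ?thesis using \<open>e > 0\<close> by simp
    qed
    then show "\<exists>N. \<forall>n\<ge>N. norm (X n - abs_L2 g) < e" by blast
  qed
  then show "convergent X" by (auto simp: convergent_def)
qed

section \<open>Projection and Riesz representation in Hilbert spaces\<close>

text \<open>
  The parallelogram law, with the midpoint of \<open>a\<close> and \<open>b\<close> at distance at least \<open>d\<close> from \<open>x\<close>. It gives
  both the Cauchy property of minimising sequences and the uniqueness of the minimiser.
\<close>

lemma convex_midpoint_bound:
  fixes A :: "'a::real_inner set"
  assumes "convex A" "a \<in> A" "b \<in> A" "0 \<le> d" "\<And>y. y \<in> A \<Longrightarrow> d \<le> dist x y"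
  shows "(dist a b)\<^sup>2 \<le> 2 * (dist x a)\<^sup>2 + 2 * (dist x b)\<^sup>2 - 4 * d\<^sup>2"
proof -
  let ?m = "(1/2) *\<^sub>R a + (1/2) *\<^sub>R b"
  have "?m \<in> A" using assms(1-3) by (intro convexD) auto
  then have "d\<^sup>2 \<le> (dist x ?m)\<^sup>2" using assms(4,5) by (intro power_mono) auto
  moreover have "(dist a b)\<^sup>2 = 2 * (dist x a)\<^sup>2 + 2 * (dist x b)\<^sup>2 - 4 * (dist x ?m)\<^sup>2"
    unfolding dist_norm power2_norm_eq_inner
    by (simp add: inner_diff_left inner_diff_right inner_add_left inner_add_right inner_commute)
  ultimately show ?thesis by linarith
qed

lemma closest_point_ex1:
  fixes A :: "'a::{real_inner, complete_space} set"
  assumes "closed A" "convex A" "A \<noteq> {}"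
  shows "\<exists>!p. p \<in> A \<and> (\<forall>y\<in>A. dist x p \<le> dist x y)"
proof (rule ex_ex1I)
  define d where "d = infdist x A"
  have d0: "0 \<le> d" by (simp add: d_def infdist_nonneg)
  have d: "d \<le> dist x y" if "y \<in> A" for y using that by (simp add: d_def infdist_le)
  have "\<exists>y\<in>A. (dist x y)\<^sup>2 < d\<^sup>2 + 1 / real (Suc n)" for n
  proof (rule ccontr)
    assume "\<not> ?thesis"
    then have *: "sqrt (d\<^sup>2 + 1 / real (Suc n)) \<le> dist x y" if "y \<in> A" for y
      using that by (intro real_le_lsqrt) (auto simp: not_less)
    have "sqrt (d\<^sup>2 + 1 / real (Suc n)) \<le> d"
      unfolding d_def infdist_notempty[OF assms(3)]
      using * assms(3) by (intro cINF_greatest) (auto simp: d_def infdist_notempty[OF assms(3)])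
    then have "d\<^sup>2 + 1 / real (Suc n) \<le> d\<^sup>2"
      by (rule sqrt_le_D)
    then show False by (simp add: field_simps)
  qed
  then obtain a where a: "\<And>n. a n \<in> A" "\<And>n. (dist x (a n))\<^sup>2 < d\<^sup>2 + 1 / real (Suc n)"
    by metis
  have "Cauchy a"
    unfolding Cauchy_def
  proof (intro allI impI)
    fix e :: real assume e: "e > 0"
    obtain N where N: "inverse (real (Suc N)) < e\<^sup>2 / 4"
      using reals_Archimedean[of "e\<^sup>2 / 4"] e by auto
    have "dist (a i) (a j) < e" if "i \<ge> N" "j \<ge> N" for i j
    proof -
      have "1 / real (Suc i) \<le> inverse (real (Suc N))" "1 / real (Suc j) \<le> inverse (real (Suc N))"
        using that by (simp_all add: inverse_eq_divide frac_le)
      moreover have "(dist (a i) (a j))\<^sup>2 \<le> 2 * (dist x (a i))\<^sup>2 + 2 * (dist x (a j))\<^sup>2 - 4 * d\<^sup>2"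
        using assms a d d0 by (intro convex_midpoint_bound) auto
      ultimately have "(dist (a i) (a j))\<^sup>2 < e\<^sup>2"
        using N a(2)[of i] a(2)[of j] by linarith
      then show ?thesis using e by (intro power2_less_imp_less[of _ e]) auto
    qed
    then show "\<exists>M. \<forall>m\<ge>M. \<forall>n\<ge>M. dist (a m) (a n) < e" by blast
  qed
  then obtain p where p: "a \<longlonglongrightarrow> p" using Cauchy_convergent convergent_def by blast
  have "p \<in> A" using closed_sequentially[OF assms(1)] a(1) p by blast
  moreover have "dist x p \<le> d"
  proof (rule power2_le_imp_le[OF _ d0])
    have "(\<lambda>n. (dist x (a n))\<^sup>2) \<longlonglongrightarrow> (dist x p)\<^sup>2" by (intro tendsto_intros p)
    moreover have "(\<lambda>n. d\<^sup>2 + 1 / real (Suc n)) \<longlonglongrightarrow> d\<^sup>2 + 0"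
      by (intro tendsto_add tendsto_const LIMSEQ_Suc[OF lim_1_over_n])
    ultimately have "(dist x p)\<^sup>2 \<le> d\<^sup>2 + 0"
      by (rule LIMSEQ_le) (use a(2) in \<open>auto intro: less_imp_le\<close>)
    then show "(dist x p)\<^sup>2 \<le> d\<^sup>2" by simp
  qed
  ultimately show "\<exists>p. p \<in> A \<and> (\<forall>y\<in>A. dist x p \<le> dist x y)"
    using d by force
next
  fix p q assume p: "p \<in> A \<and> (\<forall>y\<in>A. dist x p \<le> dist x y)" and q: "q \<in> A \<and> (\<forall>y\<in>A. dist x q \<le> dist x y)"
  then have "dist x p = dist x q" by force
  moreover have "(dist p q)\<^sup>2 \<le> 2 * (dist x p)\<^sup>2 + 2 * (dist x q)\<^sup>2 - 4 * (dist x p)\<^sup>2"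
    using assms(2) p q by (intro convex_midpoint_bound) auto
  ultimately show "p = q" by simp
qed

lemma
  fixes A :: "'a::{real_inner, complete_space} set"
  assumes "closed A" "convex A" "A \<noteq> {}"
  shows proj_in: "proj A x \<in> A"
    and proj_le: "y \<in> A \<Longrightarrow> dist x (proj A x) \<le> dist x y"
  using theI'[OF closest_point_ex1[OF assms, of x]] unfolding proj_def by auto

lemma proj_variational:
  fixes A :: "'a::{real_inner, complete_space} set"
  assumes A: "closed A" "convex A" and y: "y \<in> A"
  shows "inner (x - proj A x) (y - proj A x) \<le> 0"
  using y proj_in[OF A, of x] proj_le[OF A, of _ x]
  by (intro any_closest_point_dot[OF A(2,1)]) auto

text \<open>
  The representing vector is proportional to the element \<open>p\<close> of smallest norm in the affine hyperplane
  where the functional equals one, since \<open>p\<close> is orthogonal to the kernel. Linearity and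
  boundedness are only assumed on the subspace, as for the functionals in \<open>H_minus1\<close>.
\<close>

lemma Riesz_subspace:
  fixes S :: "'a::{real_inner, complete_space} set"
  assumes S: "subspace S" "closed S"
    and add: "\<And>x y. x \<in> S \<Longrightarrow> y \<in> S \<Longrightarrow> F (x + y) = F x + F y"
    and scale: "\<And>c x. x \<in> S \<Longrightarrow> F (c *\<^sub>R x) = c * F x"
    and bound: "\<And>x. x \<in> S \<Longrightarrow> \<bar>F x\<bar> \<le> C * norm x"
  shows "\<exists>w\<in>S. \<forall>x\<in>S. inner w x = F x"
proof (cases "\<forall>x\<in>S. F x = 0")
  case True
  then show ?thesis using subspace_0[OF S(1)] by (intro bexI[of _ 0]) auto
next
  case False
  then obtain z where z: "z \<in> S" "F z \<noteq> 0" by auto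
  have diff: "F (x - y) = F x - F y" if "x \<in> S" "y \<in> S" for x y
    using add[of x "- 1 *\<^sub>R y"] scale[of y "-1"] that subspace_scale[OF S(1), of y "-1"] by simp
  define A where "A = {y\<in>S. F y = 1}"
  have "(1 / F z) *\<^sub>R z \<in> A" using z S(1) by (simp add: A_def scale subspace_scale)
  then have ne: "A \<noteq> {}" by auto
  have cv: "convex A"
    unfolding convex_def A_def using S(1)
    by (auto simp: add scale subspace_add subspace_scale)
  have cl: "closed A"
    unfolding closed_sequential_limits
  proof (intro allI impI, elim conjE)
    fix a l assume a: "\<forall>n. a n \<in> A" and l: "a \<longlonglongrightarrow> l"
    have lS: "l \<in> S" using closed_sequentially[OF S(2) _ l] a by (auto simp: A_def)
    have "(\<lambda>n. C * norm (l - a n)) \<longlonglongrightarrow> C * norm (l - l)" by (intro tendsto_intros l)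
    moreover have "\<bar>F l - 1\<bar> \<le> C * norm (l - a n)" for n
      using bound[of "l - a n"] diff[of l "a n"] a lS S(1) by (auto simp: A_def subspace_diff)
    ultimately have "\<bar>F l - 1\<bar> \<le> C * norm (l - l)"
      by (intro LIMSEQ_le_const) auto
    then show "l \<in> A" using lS by (simp add: A_def)
  qed
  define p where "p = proj A 0"
  have p: "p \<in> A" unfolding p_def by (rule proj_in[OF cl cv ne])
  then have pS: "p \<in> S" and Fp: "F p = 1" by (auto simp: A_def)
  have orth: "inner p x = 0" if x: "x \<in> S" "F x = 0" for x
  proof -
    have "inner p x \<ge> 0" if "x \<in> S" "F x = 0" for x
    proof -
      have "p + x \<in> A" using pS Fp that S(1) by (simp add: A_def add subspace_add)
      from proj_variational[OF cl cv this, of 0, folded p_def] show ?thesis by simp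
    qed
    from this[of x] this[of "-1 *\<^sub>R x"] x show ?thesis
      using subspace_scale[OF S(1), of x "-1"] scale[of x "-1"] by simp
  qed
  have p0: "inner p p \<noteq> 0" using Fp scale[OF pS, of 0] by auto
  show ?thesis
  proof (intro bexI ballI)
    fix x assume x: "x \<in> S"
    have "inner p (x - F x *\<^sub>R p) = 0"
      using x pS S(1) by (intro orth) (auto simp: diff scale Fp subspace_diff subspace_scale)
    then show "inner ((1 / inner p p) *\<^sub>R p) x = F x"
      using p0 by (simp add: inner_diff_right field_simps)
  qed (use pS S(1) in \<open>simp add: subspace_scale\<close>)
qed

section \<open>Trigonometric polynomials and their density\<close>

lemma integrable_torus_continuous:
  fixes f :: "'a::euclidean_space \<Rightarrow> real"
  assumes "continuous_on UNIV f"
  shows "integrable torus f"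
proof -
  obtain K where K: "\<And>x. x \<in> cbox 0 One \<Longrightarrow> norm (f x) \<le> K"
    using compact_continuous_image[OF continuous_on_subset[OF assms], of "cbox 0 One"]
    by (metis bounded_iff compact_cbox compact_imp_bounded image_eqI subset_UNIV)
  show ?thesis
    by (rule torus.integrable_const_bound[of _ K])
      (use K assms in \<open>auto intro!: borel_measurable_torus borel_measurable_continuous_onI\<close>)
qed

lemma sq_int_continuous: "continuous_on UNIV f \<Longrightarrow> periodic f \<Longrightarrow> sq_int f"
  by (auto simp: sq_int_def intro!: borel_measurable_continuous_onI integrable_torus_continuous
      continuous_intros)

text \<open>
  A plane wave with frequency \<open>n\<close> and phase \<open>c\<close>; the phase covers the sines. It is periodic when \<open>n\<close>
  lies in the period lattice.
\<close>

definition wave :: "'a::euclidean_space \<Rightarrow> real \<Rightarrow> 'a \<Rightarrow> real"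
  where "wave n c x = cos (2 * pi * (n \<bullet> x) + c)"

text \<open>
  Real trigonometric polynomials: the linear span of the plane waves with lattice frequencies.
\<close>

inductive_set trig :: "('a::euclidean_space \<Rightarrow> real) set" where
  wave: "n \<in> lattice \<Longrightarrow> wave n c \<in> trig"
| add: "f \<in> trig \<Longrightarrow> g \<in> trig \<Longrightarrow> (\<lambda>x. f x + g x) \<in> trig"
| scale: "f \<in> trig \<Longrightarrow> (\<lambda>x. c * f x) \<in> trig"

lemma lattice_0 [simp]: "0 \<in> lattice" by (simp add: lattice_def)
lemma lattice_add: "n \<in> lattice \<Longrightarrow> m \<in> lattice \<Longrightarrow> n + m \<in> lattice"
  by (simp add: lattice_def inner_add_left)
lemma lattice_diff: "n \<in> lattice \<Longrightarrow> m \<in> lattice \<Longrightarrow> n - m \<in> lattice"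
  by (simp add: lattice_def inner_diff_left)

lemma trig_const: "(\<lambda>_. c) \<in> trig"
  using trig.scale[OF trig.wave[OF lattice_0, of 0], of c] by (simp add: wave_def)

text \<open>
  The product-to-sum formula makes the trigonometric polynomials an algebra.
\<close>

lemma wave_mult: "wave n c x * wave m d x = (1/2) * wave (n - m) (c - d) x + (1/2) * wave (n + m) (c + d) x"
proof -
  have "2 * pi * ((n - m) \<bullet> x) + (c - d) = (2 * pi * (n \<bullet> x) + c) - (2 * pi * (m \<bullet> x) + d)"
    "2 * pi * ((n + m) \<bullet> x) + (c + d) = (2 * pi * (n \<bullet> x) + c) + (2 * pi * (m \<bullet> x) + d)"
    by (simp_all add: inner_add_left inner_diff_left algebra_simps)
  then show ?thesis unfolding wave_def by (simp only: cos_times_cos) (simp add: field_simps)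
qed

lemma trig_mult:
  assumes "f \<in> trig" "g \<in> trig"
  shows "(\<lambda>x. f x * g x) \<in> trig"
  using assms(1)
proof induction
  case (wave n c)
  show ?case using assms(2)
  proof induction
    case (wave m d)
    then show ?case unfolding wave_mult
      using \<open>n \<in> lattice\<close> by (intro trig.intros lattice_add lattice_diff)
  next
    case (add f g)
    then show ?case using trig.add[OF add.IH] by (simp add: distrib_left)
  next
    case (scale f e)
    then show ?case using trig.scale[OF scale.IH, of e] by (simp add: mult.left_commute)
  qed
next
  case (add f h)
  then show ?case using trig.add[OF add.IH] by (simp add: distrib_right)
next
  case (scale f e)
  then show ?case using trig.scale[OF scale.IH, of e] by (simp add: mult.assoc)
qed

lemma trig_diff: "f \<in> trig \<Longrightarrow> g \<in> trig \<Longrightarrow> (\<lambda>x. f x - g x) \<in> trig"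
  using trig.add[of f "\<lambda>x. (-1) * g x"] trig.scale[of g "-1"] by simp

lemma trig_polynomial:
  assumes "real_polynomial_function p" "f \<in> trig"
  shows "(\<lambda>x. p (f x)) \<in> trig"
  using assms(1)
proof induction
  case (linear p)
  have "p (f x) = p 1 * f x" for x
    using linear_scale[OF bounded_linear.linear[OF linear], of "f x" 1] by (simp add: mult.commute)
  then show ?case using trig.scale[OF assms(2), of "p 1"] by simp
next
  case (const c)
  show ?case by (rule trig_const)
next
  case (add p q)
  then show ?case by (intro trig.add)
next
  case (mult p q)
  then show ?case by (intro trig_mult)
qed

lemma wave_has_derivative:
  "(wave n c has_derivative (\<lambda>h. 2 * pi * (n \<bullet> h) * wave n (c + pi / 2) x)) (at x)"
proof -
  have "wave n (c + pi / 2) x = - sin (2 * pi * (n \<bullet> x) + c)"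
    by (simp add: wave_def cos_add add.assoc[symmetric])
  then show ?thesis
    unfolding wave_def[abs_def] by (auto intro!: derivative_eq_intros simp: algebra_simps)
qed

lemma frechet_derivative_wave:
  "frechet_derivative (wave n c) (at x) b = 2 * pi * (n \<bullet> b) * wave n (c + pi / 2) x"
  using frechet_derivative_at[OF wave_has_derivative[of n c x]] by metis

lemma trig_deriv:
  assumes "f \<in> trig"
  shows "f differentiable_on UNIV \<and> (\<forall>b. (\<lambda>x. frechet_derivative f (at x) b) \<in> trig)"
  using assms
proof induction
  case (wave n c)
  have "wave n c differentiable_on UNIV"
    using wave_has_derivative by (auto simp: differentiable_on_def differentiable_def)
  moreover have "(\<lambda>x. frechet_derivative (wave n c) (at x) b) \<in> trig" for b
    unfolding frechet_derivative_wave by (intro trig.intros wave)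
  ultimately show ?case by blast
next
  case (add f g)
  then have d: "f differentiable (at x)" "g differentiable (at x)" for x
    by (auto simp: differentiable_on_def)
  have "frechet_derivative (\<lambda>x. f x + g x) (at x) = (\<lambda>b. frechet_derivative f (at x) b + frechet_derivative g (at x) b)" for x
    by (rule frechet_derivative_at[symmetric]) (intro has_derivative_add d[unfolded frechet_derivative_works])
  then show ?case using add by (auto intro: trig.add differentiable_on_add)
next
  case (scale f c)
  then have d: "f differentiable (at x)" for x
    by (auto simp: differentiable_on_def)
  have "frechet_derivative (\<lambda>x. c * f x) (at x) = (\<lambda>b. c * frechet_derivative f (at x) b)" for x
    by (rule frechet_derivative_at[symmetric]) (intro has_derivative_mult_right d[unfolded frechet_derivative_works])
  then show ?case using scale by (auto intro: trig.scale differentiable_on_mult)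
qed

lemma trig_smooth: "f \<in> trig \<Longrightarrow> smooth f"
proof -
  have "f \<in> trig \<Longrightarrow> Ck n f" for n
  proof (induction n arbitrary: f)
    case 0
    then show ?case using trig_deriv[of f] by (simp add: differentiable_imp_continuous_on)
  qed (use trig_deriv in auto)
  then show "f \<in> trig \<Longrightarrow> smooth f" by (simp add: smooth_def)
qed

lemma trig_periodic: "f \<in> trig \<Longrightarrow> periodic f"
proof (induction rule: trig.induct)
  case (wave n c)
  show ?case unfolding periodic_def
  proof (intro allI ballI)
    fix x b :: 'a assume "b \<in> Basis"
    then obtain k where k: "n \<bullet> b = of_int k" using wave by (auto simp: lattice_def elim!: Ints_cases)
    have "wave n c (x + b) = cos ((2 * pi * (n \<bullet> x) + c) + 2 * pi * of_int k)"
      by (simp add: wave_def inner_add_right k algebra_simps)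
    also have "\<dots> = wave n c x" by (simp only: cos_add sin_int_2pin cos_int_2pin wave_def) simp
    finally show "wave n c (x + b) = wave n c x" .
  qed
qed (auto simp: periodic_def)

lemma trig_continuous: "f \<in> trig \<Longrightarrow> continuous_on UNIV f"
  using trig_deriv differentiable_imp_continuous_on by blast

lemma trig_sq_int: "f \<in> trig \<Longrightarrow> sq_int f"
  by (intro sq_int_continuous trig_continuous trig_periodic)

lemma trig_measurable: "f \<in> trig \<Longrightarrow> f \<in> borel_measurable torus"
  by (intro sq_int_borel_torus trig_sq_int)

text \<open>
  The indicator of \<open>B\<close> is an \<open>L1\<close> limit of trigonometric polynomials with values in \<open>[0, 1]\<close>. The
  bounds hold everywhere, so that the approximants are admissible as nonnegative test functions.
\<close>

definition trig_approx :: "'a::euclidean_space set \<Rightarrow> bool"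
  where "trig_approx B \<longleftrightarrow> (\<forall>e>0. \<exists>\<phi>\<in>trig. (\<forall>x. 0 \<le> \<phi> x \<and> \<phi> x \<le> 1) \<and>
    (\<integral>x. \<bar>\<phi> x - indicator B x\<bar> \<partial>torus) < e)"

lemma indicator_measurable_torus [measurable]: "B \<in> sets borel \<Longrightarrow> (\<lambda>x. indicator B x :: real) \<in> borel_measurable torus"
  by (intro borel_measurable_torus borel_measurable_indicator) simp

lemma integrable_trig_indicator:
  assumes "\<phi> \<in> trig" "B \<in> sets borel"
  shows "integrable torus (\<lambda>x. \<bar>\<phi> x - indicator B x\<bar>)"
proof -
  have "integrable torus (\<lambda>x. indicator B x :: real)"
    using assms by (intro torus.integrable_const_bound[of _ 1]) auto
  then show ?thesis using sq_int_integrable[OF trig_sq_int[OF assms(1)]] by auto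
qed

lemma trig_approx_lim:
  assumes B: "\<And>n. trig_approx (B n)" "\<And>n. B n \<in> sets borel" "A \<in> sets borel"
    and lim: "\<And>x. (\<lambda>n. indicator (B n) x :: real) \<longlonglongrightarrow> indicator A x"
  shows "trig_approx A"
  unfolding trig_approx_def
proof (intro allI impI)
  fix e :: real assume e: "e > 0"
  note [measurable] = B(2,3)
  have "(\<lambda>n. \<integral>x. \<bar>indicator (B n) x - indicat_real A x\<bar> \<partial>torus) \<longlonglongrightarrow> (\<integral>x. 0 \<partial>(torus :: 'a measure))"
  proof (rule integral_dominated_convergence[where w="\<lambda>_. 1"])
    show "AE x in torus. (\<lambda>n. \<bar>indicator (B n) x - indicat_real A x\<bar>) \<longlonglongrightarrow> 0"
      by (intro AE_I2 tendsto_rabs_zero LIM_zero lim)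
    show "AE x in torus. norm \<bar>indicator (B n) x - indicat_real A x\<bar> \<le> 1" for n
      by (intro AE_I2) (auto simp: indicator_def)
  qed (auto intro!: borel_measurable_diff borel_measurable_abs indicator_measurable_torus B)
  then have "eventually (\<lambda>n. (\<integral>x. \<bar>indicator (B n) x - indicat_real A x\<bar> \<partial>torus) < e / 2) sequentially"
    using e by (intro order_tendstoD(2)[of _ 0]) auto
  then obtain n where n: "(\<integral>x. \<bar>indicator (B n) x - indicat_real A x\<bar> \<partial>torus) < e / 2"
    by (auto simp: eventually_sequentially)
  obtain \<phi> where \<phi>: "\<phi> \<in> trig" "\<forall>x. 0 \<le> \<phi> x \<and> \<phi> x \<le> 1"
    and d: "(\<integral>x. \<bar>\<phi> x - indicator (B n) x\<bar> \<partial>torus) < e / 2"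
    using B(1)[of n] e unfolding trig_approx_def by (meson half_gt_zero)
  have int: "integrable torus (\<lambda>x. \<bar>indicator (B n) x - indicat_real A x\<bar>)"
    by (intro torus.integrable_const_bound[of _ 1] AE_I2 borel_measurable_diff borel_measurable_abs
        indicator_measurable_torus B) (auto simp: indicator_def)
  have "(\<integral>x. \<bar>\<phi> x - indicator A x\<bar> \<partial>torus) \<le>
      (\<integral>x. \<bar>\<phi> x - indicator (B n) x\<bar> + \<bar>indicator (B n) x - indicator A x\<bar> \<partial>torus)"
    by (intro integral_mono Bochner_Integration.integrable_add integrable_trig_indicator \<phi> B int) auto
  also have "\<dots> = (\<integral>x. \<bar>\<phi> x - indicator (B n) x\<bar> \<partial>torus) + (\<integral>x. \<bar>indicator (B n) x - indicat_real A x\<bar> \<partial>torus)"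
    by (intro Bochner_Integration.integral_add integrable_trig_indicator \<phi> B int)
  finally show "\<exists>\<phi>\<in>trig. (\<forall>x. 0 \<le> \<phi> x \<and> \<phi> x \<le> 1) \<and> (\<integral>x. \<bar>\<phi> x - indicator A x\<bar> \<partial>torus) < e"
    using n d \<phi> by (intro bexI[of _ \<phi>] conjI) auto
qed

lemma trig_approx_empty: "trig_approx {}"
  unfolding trig_approx_def by (auto intro!: bexI[of _ "\<lambda>_. 0"] trig_const)

lemma trig_approx_compl:
  assumes "trig_approx B"
  shows "trig_approx (UNIV - B)"
  unfolding trig_approx_def
proof (intro allI impI)
  fix e :: real assume e: "e > 0"
  then obtain \<phi> where \<phi>: "\<phi> \<in> trig" "\<forall>x. 0 \<le> \<phi> x \<and> \<phi> x \<le> 1" "(\<integral>x. \<bar>\<phi> x - indicator B x\<bar> \<partial>torus) < e"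
    using assms by (auto simp: trig_approx_def)
  have "\<bar>(1 - \<phi> x) - indicator (UNIV - B) x\<bar> = \<bar>\<phi> x - indicator B x\<bar>" for x
    by (auto simp: indicator_def)
  then show "\<exists>\<phi>\<in>trig. (\<forall>x. 0 \<le> \<phi> x \<and> \<phi> x \<le> 1) \<and> (\<integral>x. \<bar>\<phi> x - indicator (UNIV - B) x\<bar> \<partial>torus) < e"
    using \<phi> by (intro bexI[of _ "\<lambda>x. 1 - \<phi> x"]) (auto intro!: trig_diff trig_const)
qed

lemma trig_approx_Un:
  assumes "trig_approx A" "trig_approx B" "A \<in> sets borel" "B \<in> sets borel"
  shows "trig_approx (A \<union> B)"
  unfolding trig_approx_def
proof (intro allI impI)
  fix e :: real assume e: "e > 0"
  then obtain \<phi> where \<phi>: "\<phi> \<in> trig" "\<And>x. 0 \<le> \<phi> x" "\<And>x. \<phi> x \<le> 1" "(\<integral>x. \<bar>\<phi> x - indicator A x\<bar> \<partial>torus) < e / 2"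
    using assms(1) unfolding trig_approx_def by (meson half_gt_zero)
  obtain \<psi> where \<psi>: "\<psi> \<in> trig" "\<And>x. 0 \<le> \<psi> x" "\<And>x. \<psi> x \<le> 1" "(\<integral>x. \<bar>\<psi> x - indicator B x\<bar> \<partial>torus) < e / 2"
    using assms(2) e unfolding trig_approx_def by (meson half_gt_zero)
  define \<theta> where "\<theta> x = 1 - (1 - \<phi> x) * (1 - \<psi> x)" for x
  have \<theta>: "\<theta> \<in> trig" unfolding \<theta>_def[abs_def] by (intro trig_diff trig_const trig_mult \<phi> \<psi>)
  have r: "0 \<le> \<theta> x \<and> \<theta> x \<le> 1" for x
    using \<phi>(2,3)[of x] \<psi>(2,3)[of x] by (auto simp: \<theta>_def mult_le_one)
  have "\<bar>\<theta> x - indicator (A \<union> B) x\<bar> \<le> \<bar>\<phi> x - indicator A x\<bar> + \<bar>\<psi> x - indicator B x\<bar>" for x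
  proof -
    have m: "0 \<le> (1 - \<phi> x) * (1 - \<psi> x)" "(1 - \<phi> x) * (1 - \<psi> x) \<le> 1 - \<phi> x" "(1 - \<phi> x) * (1 - \<psi> x) \<le> 1 - \<psi> x"
      using \<phi>(2,3)[of x] \<psi>(2,3)[of x] by (auto intro: mult_left_le mult_left_le_one_le)
    have "\<theta> x \<le> \<phi> x + \<psi> x"
      using \<phi>(2)[of x] \<psi>(2)[of x] by (simp add: \<theta>_def algebra_simps)
    then show ?thesis
      using m \<phi>(2,3)[of x] \<psi>(2,3)[of x]
      by (cases "x \<in> A"; cases "x \<in> B") (simp_all add: \<theta>_def)
  qed
  then have "(\<integral>x. \<bar>\<theta> x - indicator (A \<union> B) x\<bar> \<partial>torus) \<le>
      (\<integral>x. \<bar>\<phi> x - indicator A x\<bar> + \<bar>\<psi> x - indicator B x\<bar> \<partial>torus)"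
    using assms by (intro integral_mono Bochner_Integration.integrable_add integrable_trig_indicator \<phi> \<psi> \<theta>) auto
  also have "\<dots> = (\<integral>x. \<bar>\<phi> x - indicator A x\<bar> \<partial>torus) + (\<integral>x. \<bar>\<psi> x - indicator B x\<bar> \<partial>torus)"
    using assms by (intro Bochner_Integration.integral_add integrable_trig_indicator \<phi> \<psi>) auto
  finally show "\<exists>\<phi>\<in>trig. (\<forall>x. 0 \<le> \<phi> x \<and> \<phi> x \<le> 1) \<and> (\<integral>x. \<bar>\<phi> x - indicator (A \<union> B) x\<bar> \<partial>torus) < e"
    using \<theta> r \<phi> \<psi> by (intro bexI[of _ \<theta>]) auto
qed

lemma trig_approx_cong:
  assumes "trig_approx A" "\<And>x. x \<in> cbox 0 One \<Longrightarrow> x \<in> A \<longleftrightarrow> x \<in> B"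
  shows "trig_approx B"
proof -
  have "(\<integral>x. \<bar>\<phi> x - indicator A x\<bar> \<partial>torus) = (\<integral>x. \<bar>\<phi> x - indicator B x\<bar> \<partial>torus)" for \<phi> :: "'a \<Rightarrow> real"
    using assms(2) by (intro Bochner_Integration.integral_cong) (auto simp: indicator_def)
  then show ?thesis using assms(1) by (simp add: trig_approx_def)
qed

text \<open>
  Polynomials with values in \<open>[0, 1]\<close> on an interval that tend to the step function away from its jump.
\<close>

lemma polynomial_step:
  fixes K :: real
  obtains r :: "nat \<Rightarrow> real \<Rightarrow> real" where "\<forall>n. real_polynomial_function (r n)"
    and "\<forall>n. \<forall>t\<in>{-K..K}. 0 \<le> r n t \<and> r n t \<le> 1"
    and "\<forall>t\<in>{-K..K}. 0 < t \<longrightarrow> (\<lambda>n. r n t) \<longlonglongrightarrow> 1"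
    and "\<forall>t\<in>{-K..K}. t < 0 \<longrightarrow> (\<lambda>n. r n t) \<longlonglongrightarrow> 0"
proof -
  \<comment> \<open>The ramp \<open>c n\<close> is squeezed into \<open>[\<epsilon> n, 1 - \<epsilon> n]\<close>, so that a polynomial within \<open>\<epsilon> n\<close> of it
    still has values in \<open>[0, 1]\<close>.\<close>
  define \<epsilon> where "\<epsilon> n = 1 / (real n + 3)" for n
  have \<epsilon>: "0 < \<epsilon> n" "\<epsilon> n < 1/2" for n by (auto simp: \<epsilon>_def field_simps)
  have lim\<epsilon>: "\<epsilon> \<longlonglongrightarrow> 0" unfolding \<epsilon>_def
    using LIMSEQ_ignore_initial_segment[OF lim_1_over_n, of 3] by simp
  define c where "c n t = max 0 (min 1 (real n * t))" for n and t :: real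
  define g where "g n t = \<epsilon> n + (1 - 2 * \<epsilon> n) * c n t" for n t
  have c: "0 \<le> c n t" "c n t \<le> 1" for n t by (auto simp: c_def)
  have "\<exists>p. real_polynomial_function p \<and> (\<forall>t\<in>{-K..K}. \<bar>g n t - p t\<bar> < \<epsilon> n)" for n
  proof -
    have "continuous_on {-K..K} (g n)" unfolding g_def c_def by (intro continuous_intros)
    from Stone_Weierstrass_real_polynomial_function[OF compact_Icc this \<epsilon>(1)[of n]]
    show ?thesis by metis
  qed
  then obtain r where r: "\<And>n. real_polynomial_function (r n)"
    and rg: "\<And>n t. t \<in> {-K..K} \<Longrightarrow> \<bar>g n t - r n t\<bar> < \<epsilon> n" by metis
  have gb: "\<epsilon> n \<le> g n t" "g n t \<le> 1 - \<epsilon> n" for n t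
  proof -
    have "0 \<le> (1 - 2 * \<epsilon> n) * c n t" "(1 - 2 * \<epsilon> n) * c n t \<le> 1 - 2 * \<epsilon> n"
      using \<epsilon>(2)[of n] c[of n t] by (auto intro: mult_left_le)
    then show "\<epsilon> n \<le> g n t" "g n t \<le> 1 - \<epsilon> n" by (auto simp: g_def)
  qed
  have lim: "(\<lambda>n. r n t) \<longlonglongrightarrow> l" if t: "t \<in> {-K..K}" and cl: "(\<lambda>n. c n t) \<longlonglongrightarrow> l" for t l
  proof -
    have "(\<lambda>n. r n t - g n t) \<longlonglongrightarrow> 0"
      by (rule Lim_null_comparison[OF _ lim\<epsilon>]) (use rg[OF t] in \<open>auto simp: abs_minus_commute intro!: always_eventually less_imp_le\<close>)
    moreover have "(\<lambda>n. g n t) \<longlonglongrightarrow> 0 + (1 - 2 * 0) * l"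
      unfolding g_def by (intro tendsto_intros lim\<epsilon> cl)
    ultimately have "(\<lambda>n. r n t - g n t + g n t) \<longlonglongrightarrow> 0 + (0 + (1 - 2 * 0) * l)" by (rule tendsto_add)
    then show ?thesis by simp
  qed
  have pos: "(\<lambda>n. c n t) \<longlonglongrightarrow> 1" if t: "0 < t" for t
  proof (rule tendsto_eventually)
    obtain N where N: "1 < real N * t" using reals_Archimedean3[OF t] by blast
    show "eventually (\<lambda>n. c n t = 1) sequentially"
    proof (rule eventually_sequentiallyI[of N])
      fix n assume "N \<le> n"
      then have "real N * t \<le> real n * t" using t by simp
      then show "c n t = 1" using N by (simp add: c_def)
    qed
  qed
  have neg: "(\<lambda>n. c n t) \<longlonglongrightarrow> 0" if "t < 0" for t
  proof -
    have "real n * t \<le> 0" for n using that by (simp add: mult_nonneg_nonpos)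
    then have "c n t = 0" for n unfolding c_def by (rule_tac max_absorb1) (simp add: min.coboundedI2)
    then show ?thesis by simp
  qed
  have "0 \<le> r n t \<and> r n t \<le> 1" if "t \<in> {-K..K}" for n t
    using rg[OF that, of n] gb[of n t] by linarith
  then show thesis using r lim[OF _ pos] lim[OF _ neg] by (intro that[of r]) auto
qed

text \<open>
  On the circle, the arc \<open>(0, a)\<close> is the set where the cosine centred at \<open>a / 2\<close> exceeds its value at
  the end points.
\<close>

lemma cos_halfspace:
  assumes a: "0 < a" "a \<le> 1" and y: "0 < y" "y < 1" "y \<noteq> a"
  shows "if y < a then cos (pi * a) < cos (2 * pi * y - pi * a) else cos (2 * pi * y - pi * a) < cos (pi * a)"
proof (cases "y < a")
  case True
  have "\<bar>2 * pi * y - pi * a\<bar> < pi * a" 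
  proof -
    have "pi * y < pi * a" "0 < pi * y" using True y by simp_all
    then show ?thesis by (auto simp: abs_if)
  qed
  moreover have "pi * a \<le> pi" using a by simp
  ultimately have "cos (pi * a) < cos \<bar>2 * pi * y - pi * a\<bar>"
    by (intro cos_monotone_0_pi) auto
  then show ?thesis using True by (simp only: cos_abs_real if_True)
next
  case False
  let ?t = "2 * pi * y - pi * a"
  have 1: "pi * a < pi * y" "pi * y < pi" "0 < pi * a" using False y a by simp_all
  have "cos ?t < cos (pi * a)"
  proof (cases "?t \<le> pi")
    case True
    then show ?thesis using 1 by (intro cos_monotone_0_pi) auto
  next
    case False
    then have "cos (2 * pi - ?t) < cos (pi * a)" using 1 by (intro cos_monotone_0_pi) auto
    then show ?thesis using cos_2pi_minus[of ?t] by simp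
  qed
  then show ?thesis using False by simp
qed

lemma trig_approx_halfspace:
  fixes i :: "'a::euclidean_space"
  assumes i: "i \<in> Basis"
  shows "trig_approx {x. x \<bullet> i < a}"
proof -
  \<comment> \<open>Only \<open>0 < a \<le> 1\<close> matters: otherwise the halfspace contains no point or every point of
    the cube.\<close>
  consider "a \<le> 0" | "1 < a" | "0 < a" "a \<le> 1" by linarith
  then show ?thesis
  proof cases
    case 1
    then show ?thesis
      using i by (intro trig_approx_cong[OF trig_approx_empty]) (fastforce simp: mem_box)
  next
    case 2
    then show ?thesis
      using i by (intro trig_approx_cong[OF trig_approx_compl[OF trig_approx_empty]]) (fastforce simp: mem_box)
  next
    case 3
    have il: "i \<in> lattice" using i by (auto simp: lattice_def inner_Basis)
    define q where "q x = wave i (- pi * a) x - cos (pi * a)" for x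
    have q: "q \<in> trig" unfolding q_def[abs_def] by (intro trig_diff trig.wave trig_const il)
    have q2: "q x \<in> {-2..2}" for x
    proof -
      have "\<bar>wave i (- pi * a) x\<bar> \<le> 1" "\<bar>cos (pi * a)\<bar> \<le> 1" by (simp_all add: wave_def)
      then show ?thesis unfolding q_def atLeastAtMost_iff by linarith
    qed
    obtain r :: "nat \<Rightarrow> real \<Rightarrow> real" where r: "\<forall>n. real_polynomial_function (r n)"
      and r01: "\<forall>n. \<forall>t\<in>{-2..2}. 0 \<le> r n t \<and> r n t \<le> 1"
      and rpos: "\<forall>t\<in>{-2..2}. 0 < t \<longrightarrow> (\<lambda>n. r n t) \<longlonglongrightarrow> 1"
      and rneg: "\<forall>t\<in>{-2..2}. t < 0 \<longrightarrow> (\<lambda>n. r n t) \<longlonglongrightarrow> 0"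
      by (rule polynomial_step[of 2])
    define \<phi> where "\<phi> n x = r n (q x)" for n x
    have \<phi>: "\<phi> n \<in> trig" for n unfolding \<phi>_def[abs_def] by (rule trig_polynomial[OF r[rule_format] q])
    have \<phi>01: "0 \<le> \<phi> n x" "\<phi> n x \<le> 1" for n x using r01 q2[of x] by (auto simp: \<phi>_def)
    note [measurable] = trig_measurable[OF \<phi>]
    let ?B = "{x. x \<bullet> i < a}"
    have "AE x in lborel. x \<bullet> i \<noteq> 0" "AE x in lborel. x \<bullet> i \<noteq> 1" "AE x in lborel. x \<bullet> i \<noteq> a"
      unfolding AE_lborel_iff_negligible using negligible_standard_hyperplane[OF i] by simp_all
    then have "AE x in torus. (\<lambda>n. \<phi> n x) \<longlonglongrightarrow> indicator ?B x"
      unfolding AE_torus_iff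
    proof eventually_elim
      case (elim x)
      show ?case
      proof
        assume "x \<in> cbox 0 One"
        then have "0 \<le> x \<bullet> i" "x \<bullet> i \<le> 1" using i by (auto simp: mem_box)
        then have "0 < x \<bullet> i" "x \<bullet> i < 1" using elim by auto
        from cos_halfspace[OF 3 this elim(3)]
        have "if x \<bullet> i < a then 0 < q x else q x < 0"
          by (simp add: q_def wave_def inner_commute[of i x] split: if_splits)
        then show "(\<lambda>n. \<phi> n x) \<longlonglongrightarrow> indicator ?B x"
          unfolding \<phi>_def using rpos rneg q2[of x] by (auto simp: indicator_def split: if_splits)
      qed
    qed
    then have "(\<lambda>n. \<integral>x. \<bar>\<phi> n x - indicator ?B x\<bar> \<partial>torus) \<longlonglongrightarrow> (\<integral>x. 0 \<partial>(torus :: 'a measure))"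
    proof (intro integral_dominated_convergence[where w="\<lambda>_. 1"])
      assume "AE x in torus. (\<lambda>n. \<phi> n x) \<longlonglongrightarrow> indicator ?B x"
      then show "AE x in torus. (\<lambda>n. \<bar>\<phi> n x - indicator ?B x\<bar>) \<longlonglongrightarrow> 0"
        by eventually_elim (intro tendsto_rabs_zero LIM_zero)
      show "AE x in torus. norm \<bar>\<phi> n x - indicator ?B x\<bar> \<le> 1" for n
      proof (intro AE_I2)
        fix x show "norm \<bar>\<phi> n x - indicator ?B x\<bar> \<le> 1"
          using \<phi>01[of n x] by (auto simp: indicator_def abs_if)
      qed
    qed (auto intro!: borel_measurable_diff borel_measurable_abs indicator_measurable_torus)
    then have lim: "(\<lambda>n. \<integral>x. \<bar>\<phi> n x - indicator ?B x\<bar> \<partial>torus) \<longlonglongrightarrow> 0" by simp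
    show ?thesis
      unfolding trig_approx_def
    proof (intro allI impI)
      fix e :: real assume "e > 0"
      then have "eventually (\<lambda>n. (\<integral>x. \<bar>\<phi> n x - indicator ?B x\<bar> \<partial>torus) < e) sequentially"
        by (rule order_tendstoD(2)[OF lim])
      then show "\<exists>\<phi>\<in>trig. (\<forall>x. 0 \<le> \<phi> x \<and> \<phi> x \<le> 1) \<and> (\<integral>x. \<bar>\<phi> x - indicator ?B x\<bar> \<partial>torus) < e"
        using \<phi> \<phi>01 by (auto simp: eventually_sequentially intro!: bexI[of _ "\<phi> _"])
    qed
  qed
qed

text \<open>
  The sets with property \<open>trig_approx\<close> form a \<open>\<sigma>\<close>-algebra containing the halfspaces that generate the
  Borel sets.
\<close>

lemma trig_approx_borel:
  fixes B :: "'a::euclidean_space set"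
  assumes "B \<in> sets borel"
  shows "trig_approx B"
proof -
  let ?G = "(\<lambda>(a, i). {x::'a. x \<bullet> i < a}) ` (UNIV \<times> Basis)"
  have eq: "sets (borel :: 'a measure) = sigma_sets UNIV ?G"
    by (subst borel_eq_halfspace_less) (simp add: sets_measure_of)
  have "B \<in> sigma_sets UNIV ?G" using assms eq by simp
  then show ?thesis
  proof induction
    case (Basic a)
    then show ?case by (auto intro: trig_approx_halfspace)
  next
    case Empty
    show ?case by (rule trig_approx_empty)
  next
    case (Compl a)
    then show ?case by (intro trig_approx_compl)
  next
    case (Union A)
    have A: "A i \<in> sets borel" for i using Union.hyps eq by simp
    have fin: "trig_approx (\<Union>i<n. A i)" for n
    proof (induction n)
      case 0 show ?case by (simp add: trig_approx_empty)
    next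
      case (Suc n)
      have "(\<Union>i<Suc n. A i) = (\<Union>i<n. A i) \<union> A n" by (auto simp: less_Suc_eq)
      then show ?case using Suc Union.IH A by (auto intro!: trig_approx_Un)
    qed
    show ?case
    proof (rule trig_approx_lim[OF fin])
      show "(\<lambda>n. indicator (\<Union>i<n. A i) x :: real) \<longlonglongrightarrow> indicator (\<Union>i. A i) x" for x
        by (rule LIMSEQ_indicator_UN)
    qed (use A in auto)
  qed
qed

text \<open>
  Nonnegativity in \<open>L2\<close> can be tested with nonnegative trigonometric polynomials: test with approximants
  of the indicator of the set where the function is negative.
\<close>

lemma nonneg_if_trig:
  fixes h :: "'a::euclidean_space L2"
  assumes "\<And>\<phi>. \<phi> \<in> trig \<Longrightarrow> (\<And>x. 0 \<le> \<phi> x) \<Longrightarrow> 0 \<le> (\<integral>x. L2_fun h x * \<phi> x \<partial>torus)"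
  shows "nonneg h"
proof -
  define B where "B = {x. L2_fun h x < 0}"
  have B: "B \<in> sets borel" unfolding B_def by measurable
  have "\<exists>\<phi>\<in>trig. (\<forall>x. 0 \<le> \<phi> x \<and> \<phi> x \<le> 1) \<and> (\<integral>x. \<bar>\<phi> x - indicator B x\<bar> \<partial>torus) < 1 / real (Suc n)" for n
    using trig_approx_borel[OF B] unfolding trig_approx_def by (meson of_nat_0_less_iff zero_less_Suc zero_less_divide_1_iff)
  then obtain \<phi> where \<phi>: "\<And>n. \<phi> n \<in> trig" "\<And>n x. 0 \<le> \<phi> n x \<and> \<phi> n x \<le> 1"
    "\<And>n. (\<integral>x. \<bar>\<phi> n x - indicator B x\<bar> \<partial>torus) < 1 / real (Suc n)" by metis
  note [measurable] = trig_measurable[OF \<phi>(1)]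
  have int: "integrable torus (\<lambda>x. \<phi> n x - indicator B x)" for n
    using integrable_trig_indicator[OF \<phi>(1) B] trig_measurable[OF \<phi>(1)[of n]] indicator_measurable_torus[OF B]
    by (subst (asm) integrable_abs_iff) auto
  have "(\<lambda>n. \<integral>x. norm (\<phi> n x - indicator B x) \<partial>torus) \<longlonglongrightarrow> 0"
    by (rule tendsto_sandwich[OF _ _ tendsto_const LIMSEQ_Suc[OF lim_1_over_n]])
      (use \<phi>(3) in \<open>auto intro!: always_eventually less_imp_le\<close>)
  from tendsto_L1_AE_subseq[OF int this]
  obtain s :: "nat \<Rightarrow> nat" where s: "AE x in torus. (\<lambda>n. \<phi> (s n) x - indicator B x) \<longlonglongrightarrow> 0"
    by blast
  have lim: "(\<lambda>n. \<integral>x. L2_fun h x * \<phi> (s n) x \<partial>torus) \<longlonglongrightarrow> (\<integral>x. L2_fun h x * indicator B x \<partial>torus)"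
  proof (rule integral_dominated_convergence[where w="\<lambda>x. \<bar>L2_fun h x\<bar>"])
    show "AE x in torus. (\<lambda>n. L2_fun h x * \<phi> (s n) x) \<longlonglongrightarrow> L2_fun h x * indicator B x"
      using s unfolding LIM_zero_iff by eventually_elim (intro tendsto_mult tendsto_const)
    show "AE x in torus. norm (L2_fun h x * \<phi> (s n) x) \<le> \<bar>L2_fun h x\<bar>" for n
      using \<phi>(2) by (intro AE_I2) (auto simp: abs_mult intro!: mult_left_le)
  qed (use indicator_measurable_torus[OF B] in \<open>auto\<close>)
  have "0 \<le> (\<integral>x. L2_fun h x * indicator B x \<partial>torus)"
    by (rule LIMSEQ_le_const[OF lim]) (use assms[OF \<phi>(1)] \<phi>(2) in auto)
  have intB: "integrable torus (\<lambda>x. - (L2_fun h x * indicator B x))"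
    by (rule Bochner_Integration.integrable_bound[OF integrable_L2_fun[of h]])
      (use indicator_measurable_torus[OF B] in \<open>auto simp: indicator_def\<close>)
  have ge: "AE x in torus. 0 \<le> - (L2_fun h x * indicator B x)"
    by (intro AE_I2) (auto simp: B_def indicator_def)
  have "(\<integral>x. - (L2_fun h x * indicator B x) \<partial>torus) = 0"
    using \<open>0 \<le> _\<close> integral_nonneg_AE[OF ge] by simp
  then have "AE x in torus. - (L2_fun h x * indicator B x) = 0"
    using integral_nonneg_eq_0_iff_AE[OF intB ge] by simp
  then show ?thesis unfolding nonneg_def
    by eventually_elim (auto simp: B_def indicator_def split: if_splits)
qed

text \<open>
  Completeness of the trigonometric system.
\<close>

lemma L2_eq_0_if_wave:
  fixes h :: "'a::euclidean_space L2"
  assumes "\<And>n c. n \<in> lattice \<Longrightarrow> (\<integral>x. L2_fun h x * wave n c x \<partial>torus) = 0"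
  shows "h = 0"
proof -
  have z: "inner h (abs_L2 \<phi>) = 0" if "\<phi> \<in> trig" for \<phi>
  proof -
    have "(\<integral>x. L2_fun h x * \<phi> x \<partial>torus) = 0" using that
    proof induction
      case (add f g)
      then show ?case
        by (simp add: distrib_left sq_int_mult_integrable trig_sq_int)
    next
      case (scale f c)
      then show ?case by (simp add: mult.left_commute)
    qed (rule assms)
    then show ?thesis using that by (simp add: inner_abs_L2 trig_sq_int)
  qed
  have "nonneg h"
    by (rule nonneg_if_trig) (simp add: inner_abs_L2[symmetric] trig_sq_int z)
  moreover have "nonneg (- h)"
    by (rule nonneg_if_trig) (simp add: inner_abs_L2[symmetric] trig_sq_int z)
  ultimately have "AE x in torus. L2_fun h x = 0 * L2_fun h x"
    using L2_fun_scaleR[of "-1" h] unfolding nonneg_def by eventually_elim simp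
  with L2_fun_scaleR[of 0 h] have "AE x in torus. L2_fun h x = L2_fun (0 *\<^sub>R h) x"
    by eventually_elim simp
  then have "h = 0 *\<^sub>R h" by (rule L2_eqI)
  then show ?thesis by simp
qed

section \<open>Weak derivatives\<close>

lemma smooth_differentiable:
  assumes "smooth f"
  shows "f differentiable (at x)"
proof -
  have "Ck (Suc 0) f" using assms unfolding smooth_def by blast
  then show ?thesis by (simp add: differentiable_on_def)
qed

lemma smooth_continuous:
  assumes "smooth f"
  shows "continuous_on UNIV f"
proof -
  have "Ck 0 f" using assms unfolding smooth_def by blast
  then show ?thesis by simp
qed

lemma smooth_deriv: "smooth f \<Longrightarrow> b \<in> Basis \<Longrightarrow> smooth (\<lambda>x. frechet_derivative f (at x) b)"
  unfolding smooth_def using Ck.simps(2) by blast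

lemma periodic_frechet_derivative:
  assumes "periodic f"
  shows "periodic (\<lambda>x. frechet_derivative f (at x) b)"
  unfolding periodic_def
proof (intro allI ballI)
  fix x c :: 'a assume c: "c \<in> Basis"
  have f: "f (y + c) = f y" for y using assms c by (simp add: periodic_def)
  then have f': "f (y - c) = f y" for y by (metis diff_add_cancel)
  have "(f has_derivative D) (at (x + c)) \<longleftrightarrow> (f has_derivative D) (at x)" for D
  proof
    assume D: "(f has_derivative D) (at (x + c))"
    have "((\<lambda>y. y + c) has_derivative (\<lambda>h. h)) (at x)" by (auto intro!: derivative_eq_intros)
    from has_derivative_compose[OF this D] show "(f has_derivative D) (at x)" by (simp add: f)
  next
    assume D: "(f has_derivative D) (at x)"
    have "((\<lambda>y. y - c) has_derivative (\<lambda>h. h)) (at (x + c))" by (auto intro!: derivative_eq_intros)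
    from has_derivative_compose[OF this, of f D] D show "(f has_derivative D) (at (x + c))" by (simp add: f')
  qed
  then show "frechet_derivative f (at (x + c)) b = frechet_derivative f (at x) b"
    by (simp add: frechet_derivative_def)
qed

lemma smooth_sq_int: "smooth f \<Longrightarrow> periodic f \<Longrightarrow> sq_int f"
  by (intro sq_int_continuous smooth_continuous)

lemma smooth_deriv_sq_int:
  "smooth f \<Longrightarrow> periodic f \<Longrightarrow> b \<in> Basis \<Longrightarrow> sq_int (\<lambda>x. frechet_derivative f (at x) b)"
  by (intro smooth_sq_int smooth_deriv periodic_frechet_derivative)

text \<open>
  Differentiate the constant function \<open>t \<mapsto> \<integral> F (x + t b)\<close> at \<open>0\<close>; the difference quotients are
  dominated by the maximum of the derivative over a larger cube.
\<close>

lemma integral_deriv_eq_0: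
  fixes F D :: "'a::euclidean_space \<Rightarrow> real"
  assumes F: "periodic F" "continuous_on UNIV F" and D: "continuous_on UNIV D" and b: "b \<in> Basis"
    and deriv: "\<And>x. (F has_derivative F' x) (at x)" "\<And>x. F' x b = D x"
  shows "(\<integral>x. D x \<partial>torus) = 0"
proof -
  obtain K where K: "\<And>x. x \<in> cbox 0 (One+One) \<Longrightarrow> norm (D x) \<le> K"
    using compact_continuous_image[OF continuous_on_subset[OF D], of "cbox 0 (One+One)"]
    by (metis bounded_iff compact_cbox compact_imp_bounded image_eqI subset_UNIV)
  have line: "((\<lambda>t. F (x + t *\<^sub>R b)) has_real_derivative D (x + t *\<^sub>R b)) (at t)" for x t
  proof -
    have "((\<lambda>t. F (x + t *\<^sub>R b)) has_derivative (\<lambda>h. F' (x + t *\<^sub>R b) (h *\<^sub>R b))) (at t)"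
      by (rule has_derivative_compose[OF _ deriv(1)]) (auto intro!: derivative_eq_intros)
    moreover have "F' y (h *\<^sub>R b) = D y * h" for y h
      using linear_scale[OF has_derivative_linear[OF deriv(1)[of y]], of h b] deriv(2)[of y] by simp
    ultimately show ?thesis by (simp add: has_field_derivative_def)
  qed
  define q where "q n x = real (Suc n) * (F (x + (1 / real (Suc n)) *\<^sub>R b) - F x)" for n x
  have qc: "continuous_on UNIV (q n)" for n
    unfolding q_def
    by (intro continuous_intros continuous_on_compose2[OF F(2)]) auto
  have q0: "(\<integral>x. q n x \<partial>torus) = 0" for n
  proof -
    have "continuous_on UNIV (\<lambda>x. F (x + (1 / real (Suc n)) *\<^sub>R b))"
      by (intro continuous_intros continuous_on_compose2[OF F(2)]) auto
    then have "(\<integral>x. q n x \<partial>torus) = real (Suc n) *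
        ((\<integral>x. F (x + (1 / real (Suc n)) *\<^sub>R b) \<partial>torus) - (\<integral>x. F x \<partial>torus))"
      unfolding q_def
      by (subst integral_mult_right_zero, subst Bochner_Integration.integral_diff)
        (auto intro: integrable_torus_continuous F(2))
    also have "\<dots> = 0" by (subst integral_torus_shift[OF F b]) auto
    finally show ?thesis .
  qed
  have "(\<lambda>n. \<integral>x. q n x \<partial>torus) \<longlonglongrightarrow> (\<integral>x. D x \<partial>torus)"
  proof (rule integral_dominated_convergence[where w="\<lambda>_. K"])
    show "AE x in torus. (\<lambda>n. q n x) \<longlonglongrightarrow> D x"
    proof (intro AE_I2)
      fix x :: 'a
      have "((\<lambda>h. (F (x + h *\<^sub>R b) - F x) / h) \<longlongrightarrow> D x) (at 0)"
        using line[of x 0] by (simp add: has_field_derivative_iff)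
      moreover have "filterlim (\<lambda>n. 1 / real (Suc n)) (at 0) sequentially"
        unfolding filterlim_at using LIMSEQ_Suc[OF lim_1_over_n] by (auto intro!: always_eventually)
      ultimately have "(\<lambda>n. (F (x + (1 / real (Suc n)) *\<^sub>R b) - F x) / (1 / real (Suc n))) \<longlonglongrightarrow> D x"
        by (rule filterlim_compose)
      then show "(\<lambda>n. q n x) \<longlonglongrightarrow> D x" by (simp add: q_def mult.commute)
    qed
    show "AE x in torus. norm (q n x) \<le> K" for n
    proof (intro AE_I2)
      fix x :: 'a assume "x \<in> space torus"
      define t where "t = 1 / real (Suc n)"
      have t: "0 < t" "t \<le> 1" by (auto simp: t_def)
      obtain z where z: "0 < z" "z < t" "F (x + t *\<^sub>R b) - F (x + 0 *\<^sub>R b) = (t - 0) * D (x + z *\<^sub>R b)"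
        using MVT2[OF t(1), of "\<lambda>t. F (x + t *\<^sub>R b)" "\<lambda>t. D (x + t *\<^sub>R b)"] line by blast
      have "q n x = D (x + z *\<^sub>R b)" using z(3) by (simp add: q_def t_def)
      moreover have "x + z *\<^sub>R b \<in> cbox 0 (One + One)"
        using \<open>x \<in> space torus\<close> z(1,2) t b by (fastforce simp: mem_box inner_add_left inner_Basis)
      ultimately show "norm (q n x) \<le> K" using K by simp
    qed
  qed (auto intro!: borel_measurable_torus borel_measurable_continuous_onI D qc)
  then show ?thesis using q0 LIMSEQ_unique by (simp add: LIMSEQ_const_iff)
qed

lemma inner_abs_L2_abs_L2:
  assumes "sq_int f" "sq_int g"
  shows "inner (abs_L2 f) (abs_L2 g) = (\<integral>x. f x * g x \<partial>torus)"
  unfolding inner_abs_L2[OF assms(2)]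
proof (rule integral_cong_AE)
  show "AE x in torus. L2_fun (abs_L2 f) x * g x = f x * g x"
    using L2_fun_abs[OF assms(1)] by eventually_elim simp
qed (use assms[THEN sq_int_borel_torus] in measurable)

lemma has_weak_deriv_iff:
  assumes "b \<in> Basis"
  shows "has_weak_deriv b u w \<longleftrightarrow> (\<forall>\<psi>. smooth \<psi> \<and> periodic \<psi> \<longrightarrow>
    inner u (abs_L2 (\<lambda>x. frechet_derivative \<psi> (at x) b)) = - inner w (abs_L2 \<psi>))"
  unfolding has_weak_deriv_def using assms
  by (auto simp: inner_abs_L2 smooth_sq_int smooth_deriv_sq_int)

text \<open>
  Integration by parts: the derivative of the product of \<open>\<phi>\<close> with a test function integrates to zero.
\<close>

lemma trig_has_weak_deriv:
  assumes \<phi>: "\<phi> \<in> trig" and b: "b \<in> Basis"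
  shows "has_weak_deriv b (abs_L2 \<phi>) (abs_L2 (\<lambda>x. frechet_derivative \<phi> (at x) b))"
  unfolding has_weak_deriv_iff[OF b]
proof (intro allI impI, elim conjE)
  fix \<psi> :: "'a \<Rightarrow> real" assume \<psi>: "smooth \<psi>" "periodic \<psi>"
  let ?d = "\<lambda>f x. frechet_derivative f (at x) b"
  have \<phi>': "smooth \<phi>" "periodic \<phi>" using \<phi> by (simp_all add: trig_smooth trig_periodic)
  note c = smooth_continuous[OF \<psi>(1)] smooth_continuous[OF \<phi>'(1)]
    smooth_continuous[OF smooth_deriv[OF \<psi>(1) b]] smooth_continuous[OF smooth_deriv[OF \<phi>'(1) b]]
  have "(\<integral>x. \<phi> x * ?d \<psi> x + ?d \<phi> x * \<psi> x \<partial>torus) = 0"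
  proof (rule integral_deriv_eq_0[where F="\<lambda>x. \<phi> x * \<psi> x" and b=b])
    show "((\<lambda>x. \<phi> x * \<psi> x) has_derivative
        (\<lambda>h. \<phi> x * frechet_derivative \<psi> (at x) h + frechet_derivative \<phi> (at x) h * \<psi> x)) (at x)" for x
      by (intro has_derivative_mult) (use smooth_differentiable \<phi>' \<psi> frechet_derivative_works in blast)+
  qed (use \<phi>' \<psi> b in \<open>auto simp: periodic_def intro!: continuous_intros c\<close>)
  moreover have "(\<integral>x. \<phi> x * ?d \<psi> x + ?d \<phi> x * \<psi> x \<partial>torus) =
      (\<integral>x. \<phi> x * ?d \<psi> x \<partial>torus) + (\<integral>x. ?d \<phi> x * \<psi> x \<partial>torus)"
    by (intro Bochner_Integration.integral_add sq_int_mult_integrable smooth_sq_int smooth_deriv_sq_int \<phi>' \<psi> b)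
  ultimately show "inner (abs_L2 \<phi>) (abs_L2 (?d \<psi>)) = - inner (abs_L2 (?d \<phi>)) (abs_L2 \<psi>)"
    using \<phi>' \<psi> b by (simp add: inner_abs_L2_abs_L2 smooth_sq_int smooth_deriv_sq_int)
qed

lemma has_weak_deriv_unique:
  assumes "b \<in> Basis" "has_weak_deriv b u w" "has_weak_deriv b u w'"
  shows "w = w'"
proof -
  have "w - w' = 0"
  proof (rule L2_eq_0_if_wave)
    fix n :: 'a and c assume n: "n \<in> lattice"
    have "smooth (wave n c)" "periodic (wave n c)" using trig.wave[OF n] by (simp_all add: trig_smooth trig_periodic)
    then have "inner (w - w') (abs_L2 (wave n c)) = 0"
      using assms unfolding has_weak_deriv_iff[OF assms(1)] by (simp add: inner_diff_left)
    then show "(\<integral>x. L2_fun (w - w') x * wave n c x \<partial>torus) = 0"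
      using trig_sq_int[OF trig.wave[OF n]] by (simp add: inner_abs_L2)
  qed
  then show ?thesis by simp
qed

lemma weak_deriv_eq: "b \<in> Basis \<Longrightarrow> has_weak_deriv b u w \<Longrightarrow> weak_deriv b u = w"
  unfolding weak_deriv_def using has_weak_deriv_unique by blast

lemma H1_has_weak_deriv: "u \<in> H1 \<Longrightarrow> b \<in> Basis \<Longrightarrow> has_weak_deriv b u (weak_deriv b u)"
  using weak_deriv_eq unfolding H1_def by force

lemma has_weak_deriv_add:
  "b \<in> Basis \<Longrightarrow> has_weak_deriv b u w \<Longrightarrow> has_weak_deriv b v z \<Longrightarrow> has_weak_deriv b (u + v) (w + z)"
  by (simp add: has_weak_deriv_iff inner_add_left)

lemma has_weak_deriv_scaleR:
  "b \<in> Basis \<Longrightarrow> has_weak_deriv b u w \<Longrightarrow> has_weak_deriv b (c *\<^sub>R u) (c *\<^sub>R w)"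
  by (simp add: has_weak_deriv_iff)

lemma has_weak_deriv_lim:
  assumes b: "b \<in> Basis" and "\<And>n. has_weak_deriv b (u n) (w n)" "u \<longlonglongrightarrow> u'" "w \<longlonglongrightarrow> w'"
  shows "has_weak_deriv b u' w'"
  unfolding has_weak_deriv_iff[OF b]
proof (intro allI impI)
  fix \<psi> :: "'a \<Rightarrow> real" assume \<psi>: "smooth \<psi> \<and> periodic \<psi>"
  let ?d = "abs_L2 (\<lambda>x. frechet_derivative \<psi> (at x) b)"
  have "(\<lambda>n. inner (u n) ?d) \<longlonglongrightarrow> inner u' ?d" by (rule tendsto_inner[OF assms(3) tendsto_const])
  moreover have "(\<lambda>n. - inner (w n) (abs_L2 \<psi>)) \<longlonglongrightarrow> - inner w' (abs_L2 \<psi>)"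
    by (rule tendsto_minus[OF tendsto_inner[OF assms(4) tendsto_const]])
  moreover have "inner (u n) ?d = - inner (w n) (abs_L2 \<psi>)" for n
    using assms(2)[of n] \<psi> unfolding has_weak_deriv_iff[OF b] by blast
  ultimately show "inner u' ?d = - inner w' (abs_L2 \<psi>)" by (auto intro: LIMSEQ_unique)
qed

lemma H1_add: "u \<in> H1 \<Longrightarrow> v \<in> H1 \<Longrightarrow> u + v \<in> H1"
  unfolding H1_def using has_weak_deriv_add by blast

lemma H1_scaleR: "u \<in> H1 \<Longrightarrow> c *\<^sub>R u \<in> H1"
  unfolding H1_def using has_weak_deriv_scaleR by blast

lemma H1_diff: "u \<in> H1 \<Longrightarrow> v \<in> H1 \<Longrightarrow> u - v \<in> H1"
  using H1_add[of u "-1 *\<^sub>R v"] H1_scaleR[of v "-1"] by simp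

lemma weak_deriv_add: "b \<in> Basis \<Longrightarrow> u \<in> H1 \<Longrightarrow> v \<in> H1 \<Longrightarrow> weak_deriv b (u + v) = weak_deriv b u + weak_deriv b v"
  by (intro weak_deriv_eq has_weak_deriv_add H1_has_weak_deriv)

lemma weak_deriv_scaleR: "b \<in> Basis \<Longrightarrow> u \<in> H1 \<Longrightarrow> weak_deriv b (c *\<^sub>R u) = c *\<^sub>R weak_deriv b u"
  by (intro weak_deriv_eq has_weak_deriv_scaleR H1_has_weak_deriv)

lemma weak_deriv_diff:
  assumes "b \<in> Basis" "u \<in> H1" "v \<in> H1"
  shows "weak_deriv b (u - v) = weak_deriv b u - weak_deriv b v"
  using weak_deriv_add[OF assms(1,2) H1_scaleR[OF assms(3), of "-1"]] weak_deriv_scaleR[OF assms(1,3), of "-1"]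
  by simp

lemma weak_deriv_trig:
  "\<phi> \<in> trig \<Longrightarrow> b \<in> Basis \<Longrightarrow> weak_deriv b (abs_L2 \<phi>) = abs_L2 (\<lambda>x. frechet_derivative \<phi> (at x) b)"
  by (intro weak_deriv_eq trig_has_weak_deriv)

lemma trig_H1: "\<phi> \<in> trig \<Longrightarrow> abs_L2 \<phi> \<in> H1"
  unfolding H1_def using trig_has_weak_deriv by blast

lemma L_dual_commute: "L_dual \<nu> lam u v = L_dual \<nu> lam v u"
  by (simp add: L_dual_def inner_commute)

lemma L_dual_add_left: "u \<in> H1 \<Longrightarrow> v \<in> H1 \<Longrightarrow> L_dual \<nu> lam (u + v) w = L_dual \<nu> lam u w + L_dual \<nu> lam v w"
  by (simp add: L_dual_def weak_deriv_add inner_add_left sum.distrib distrib_left)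

lemma L_dual_scaleR_left: "u \<in> H1 \<Longrightarrow> L_dual \<nu> lam (c *\<^sub>R u) w = c * L_dual \<nu> lam u w"
  by (simp add: L_dual_def weak_deriv_scaleR sum_distrib_left distrib_left mult.left_commute)

lemma L_dual_diff_left: "u \<in> H1 \<Longrightarrow> v \<in> H1 \<Longrightarrow> L_dual \<nu> lam (u - v) w = L_dual \<nu> lam u w - L_dual \<nu> lam v w"
  by (simp add: L_dual_def weak_deriv_diff inner_diff_left sum_subtractf right_diff_distrib)

lemma L_dual_diff_right: "u \<in> H1 \<Longrightarrow> v \<in> H1 \<Longrightarrow> L_dual \<nu> lam w (u - v) = L_dual \<nu> lam w u - L_dual \<nu> lam w v"
  by (simp add: L_dual_commute[of _ _ w] L_dual_diff_left)

lemma L_dual_ge: "0 \<le> \<nu> \<Longrightarrow> lam * (norm u)\<^sup>2 \<le> L_dual \<nu> lam u u"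
  by (simp add: L_dual_def power2_norm_eq_inner sum_nonneg)

section \<open>Inverting the elliptic operator\<close>

lemma Basis_vec_eq: "(Basis :: (real ^ 'd) set) = range (\<lambda>i. axis i 1)"
  by (auto simp: Basis_vec_def)

lemma axis_Basis [simp]: "axis i (1::real) \<in> Basis"
  by (simp add: axis_in_Basis_iff)

lemma sum_Basis_vec: "(\<Sum>b\<in>(Basis :: (real ^ 'd) set). F b) = (\<Sum>i\<in>UNIV. F (axis i 1))"
  unfolding Basis_vec_eq by (subst sum.reindex) (auto simp: inj_on_def axis_eq_axis)

text \<open>
  The pair of a function and its gradient, scaled so that the inner product of the product Hilbert space
  becomes the bilinear form \<open>L_dual\<close>. Indexing the partial derivatives by the coordinates makes the
  target a complete inner product type. The image of \<open>H1\<close> is a closed subspace, to which the Riesz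
  representation theorem applies.
\<close>

definition grad_graph :: "real \<Rightarrow> real \<Rightarrow> (real ^ 'd) L2 \<Rightarrow> (real ^ 'd) L2 \<times> ((real ^ 'd) L2 ^ 'd)"
  where "grad_graph \<nu> lam u = (sqrt lam *\<^sub>R u, \<chi> i. sqrt \<nu> *\<^sub>R weak_deriv (axis i 1) u)"

lemma inner_grad_graph:
  assumes "0 \<le> \<nu>" "0 \<le> lam"
  shows "inner (grad_graph \<nu> lam u) (grad_graph \<nu> lam v) = L_dual \<nu> lam u v"
  using assms by (simp add: grad_graph_def L_dual_def inner_vec_def sum_Basis_vec sum_distrib_left
      mult.assoc[symmetric])

lemma grad_graph_add: "u \<in> H1 \<Longrightarrow> v \<in> H1 \<Longrightarrow> grad_graph \<nu> lam (u + v) = grad_graph \<nu> lam u + grad_graph \<nu> lam v"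
  by (simp add: grad_graph_def weak_deriv_add vec_eq_iff scaleR_add_right)

lemma grad_graph_scaleR: "u \<in> H1 \<Longrightarrow> grad_graph \<nu> lam (c *\<^sub>R u) = c *\<^sub>R grad_graph \<nu> lam u"
  by (simp add: grad_graph_def weak_deriv_scaleR vec_eq_iff mult.commute)

lemma H1_0 [simp]: "0 \<in> H1"
  using H1_scaleR[OF trig_H1[OF trig_const[of 0]], of 0] by simp

lemma subspace_grad_graph: "subspace (grad_graph \<nu> lam ` H1)"
proof (rule subspaceI)
  show "0 \<in> grad_graph \<nu> lam ` (H1 :: (real ^ 'b) L2 set)"
    using grad_graph_scaleR[OF H1_0, of \<nu> lam 0] by (intro image_eqI[of _ _ 0]) auto
qed (auto simp: grad_graph_add[symmetric] grad_graph_scaleR[symmetric] H1_add H1_scaleR)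

lemma closed_grad_graph:
  assumes \<nu>: "0 < \<nu>" and lam: "0 < lam"
  shows "closed (grad_graph \<nu> lam ` (H1 :: (real ^ 'd) L2 set))"
  unfolding closed_sequential_limits
proof (intro allI impI, elim conjE)
  fix y and l :: "(real ^ 'd) L2 \<times> ((real ^ 'd) L2 ^ 'd)"
  assume "\<forall>n. y n \<in> grad_graph \<nu> lam ` H1" and l: "y \<longlonglongrightarrow> l"
  then obtain u where u: "\<And>n. u n \<in> H1" "\<And>n. y n = grad_graph \<nu> lam (u n)"
    unfolding image_iff by metis
  define u' where "u' = (1 / sqrt lam) *\<^sub>R fst l"
  define w where "w i = (1 / sqrt \<nu>) *\<^sub>R (snd l $ i)" for i
  have "(\<lambda>n. (1 / sqrt lam) *\<^sub>R fst (y n)) \<longlonglongrightarrow> u'"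
    unfolding u'_def by (rule tendsto_scaleR[OF tendsto_const tendsto_fst[OF l]])
  then have lu: "u \<longlonglongrightarrow> u'" using lam by (simp add: u(2) grad_graph_def)
  have "(\<lambda>n. (1 / sqrt \<nu>) *\<^sub>R (snd (y n) $ i)) \<longlonglongrightarrow> w i" for i
    unfolding w_def by (rule tendsto_scaleR[OF tendsto_const tendsto_vec_nth[OF tendsto_snd[OF l]]])
  then have lw: "(\<lambda>n. weak_deriv (axis i 1) (u n)) \<longlonglongrightarrow> w i" for i
    using \<nu> by (simp add: u(2) grad_graph_def)
  have hw: "has_weak_deriv (axis i 1) u' (w i)" for i
    by (rule has_weak_deriv_lim[OF _ _ lu lw]) (auto intro: H1_has_weak_deriv u)
  then have "u' \<in> H1" unfolding H1_def Basis_vec_eq by auto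
  moreover have "grad_graph \<nu> lam u' = l"
    using weak_deriv_eq[OF _ hw] \<nu> lam
    by (simp add: grad_graph_def u'_def[symmetric] prod_eq_iff vec_eq_iff)
      (simp add: u'_def w_def)
  ultimately show "l \<in> grad_graph \<nu> lam ` H1" by blast
qed

lemma H_minus1_inner: "inner g \<in> H_minus1"
proof -
  have "norm u \<le> H1_norm u" for u :: "'a L2"
    unfolding H1_norm_def by (rule real_le_rsqrt) (simp add: sum_nonneg)
  then have "\<bar>inner g u\<bar> \<le> norm g * H1_norm u" for u
    using Cauchy_Schwarz_ineq2[of g u] by (meson mult_left_mono norm_ge_zero order_trans)
  then show ?thesis by (auto simp: H_minus1_def inner_add_right)
qed

lemma H1_norm_le:
  fixes u :: "(real ^ 'd) L2"
  assumes \<nu>: "0 < \<nu>" and lam: "0 < lam"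
  shows "H1_norm u \<le> (1 / sqrt (min \<nu> lam)) * norm (grad_graph \<nu> lam u)"
proof -
  let ?c = "min \<nu> lam"
  have c: "0 < ?c" using assms by simp
  let ?s = "\<Sum>b\<in>Basis. (norm (weak_deriv b u))\<^sup>2"
  have "?c * ((norm u)\<^sup>2 + ?s) \<le> lam * (norm u)\<^sup>2 + \<nu> * ?s"
    by (simp add: distrib_left add_mono mult_right_mono sum_nonneg)
  also have "\<dots> = (norm (grad_graph \<nu> lam u))\<^sup>2"
    using assms by (simp only: power2_norm_eq_inner inner_grad_graph[OF less_imp_le less_imp_le])
      (simp add: L_dual_def)
  finally have "(norm u)\<^sup>2 + ?s \<le> (norm (grad_graph \<nu> lam u))\<^sup>2 / ?c"
    using c by (simp add: field_simps)
  then have "H1_norm u \<le> sqrt ((norm (grad_graph \<nu> lam u))\<^sup>2 / ?c)"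
    unfolding H1_norm_def by simp
  also have "\<dots> = (1 / sqrt ?c) * norm (grad_graph \<nu> lam u)"
    by (simp add: real_sqrt_divide)
  finally show ?thesis .
qed

lemma L_dual_unique:
  assumes "0 < \<nu>" "0 < lam" "w \<in> H1" "w' \<in> H1" "\<And>\<phi>. \<phi> \<in> H1 \<Longrightarrow> L_dual \<nu> lam w \<phi> = L_dual \<nu> lam w' \<phi>"
  shows "w = w'"
proof -
  have "L_dual \<nu> lam (w - w') (w - w') = 0"
    using assms by (simp add: L_dual_diff_left H1_diff)
  then have "lam * (norm (w - w'))\<^sup>2 \<le> 0"
    using L_dual_ge[of \<nu> lam "w - w'"] assms by simp
  then show ?thesis using assms by (simp add: mult_le_0_iff)
qed

lemma L_inv_exists:
  fixes \<rho> :: "(real ^ 'd) L2 \<Rightarrow> real"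
  assumes \<nu>: "0 < \<nu>" and lam: "0 < lam" and \<rho>: "\<rho> \<in> H_minus1"
  shows "\<exists>w\<in>H1. \<forall>\<phi>\<in>H1. L_dual \<nu> lam w \<phi> = \<rho> \<phi>"
proof -
  let ?G = "grad_graph \<nu> lam :: (real ^ 'd) L2 \<Rightarrow> _"
  define F where "F y = \<rho> ((1 / sqrt lam) *\<^sub>R fst y)" for y :: "(real ^ 'd) L2 \<times> ((real ^ 'd) L2 ^ 'd)"
  have F: "F (?G u) = \<rho> u" for u using lam by (simp add: F_def grad_graph_def)
  have add: "\<rho> (u + v) = \<rho> u + \<rho> v" and scale: "\<rho> (c *\<^sub>R u) = c * \<rho> u" if "u \<in> H1" "v \<in> H1" for u v c
    using \<rho> that unfolding H_minus1_def by blast+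
  obtain C where C: "\<And>u. u \<in> H1 \<Longrightarrow> \<bar>\<rho> u\<bar> \<le> C * H1_norm u" using \<rho> unfolding H_minus1_def by blast
  have bound: "\<bar>\<rho> u\<bar> \<le> (\<bar>C\<bar> * (1 / sqrt (min \<nu> lam))) * norm (?G u)" if "u \<in> H1" for u
  proof -
    have "0 \<le> H1_norm u" by (simp add: H1_norm_def sum_nonneg)
    then have "\<bar>\<rho> u\<bar> \<le> \<bar>C\<bar> * H1_norm u" using C[OF that] by (meson abs_ge_self mult_right_mono order_trans)
    also have "\<dots> \<le> \<bar>C\<bar> * ((1 / sqrt (min \<nu> lam)) * norm (?G u))"
      by (intro mult_left_mono H1_norm_le \<nu> lam) simp
    finally show ?thesis by (simp add: mult.assoc)
  qed
  have "\<exists>w\<in>?G ` H1. \<forall>x\<in>?G ` H1. inner w x = F x"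
  proof (rule Riesz_subspace[OF subspace_grad_graph closed_grad_graph[OF \<nu> lam]])
    show "F (x + y) = F x + F y" if "x \<in> ?G ` H1" "y \<in> ?G ` H1" for x y
      using that by (auto simp: grad_graph_add[symmetric] F add)
    show "F (c *\<^sub>R x) = c * F x" if "x \<in> ?G ` H1" for c x
      using that by (auto simp: grad_graph_scaleR[symmetric] F scale)
    show "\<bar>F x\<bar> \<le> (\<bar>C\<bar> * (1 / sqrt (min \<nu> lam))) * norm x" if "x \<in> ?G ` H1" for x
      using that bound by (auto simp: F)
  qed
  then show ?thesis using \<nu> lam by (auto simp: F inner_grad_graph)
qed

lemma
  fixes \<rho> :: "(real ^ 'd) L2 \<Rightarrow> real"
  assumes "0 < \<nu>" "0 < lam" "\<rho> \<in> H_minus1"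
  shows L_inv_H1: "L_inv \<nu> lam \<rho> \<in> H1"
    and L_dual_L_inv: "\<phi> \<in> H1 \<Longrightarrow> L_dual \<nu> lam (L_inv \<nu> lam \<rho>) \<phi> = \<rho> \<phi>"
proof -
  have "\<exists>!w. w \<in> H1 \<and> (\<forall>\<phi>\<in>H1. L_dual \<nu> lam w \<phi> = \<rho> \<phi>)"
    using L_inv_exists[OF assms] L_dual_unique[OF assms(1,2)] by metis
  from theI'[OF this] show "L_inv \<nu> lam \<rho> \<in> H1" "\<phi> \<in> H1 \<Longrightarrow> L_dual \<nu> lam (L_inv \<nu> lam \<rho>) \<phi> = \<rho> \<phi>"
    unfolding L_inv_def by auto
qed

lemma L_inv_eqI:
  fixes \<rho> :: "(real ^ 'd) L2 \<Rightarrow> real"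
  assumes "0 < \<nu>" "0 < lam" "\<rho> \<in> H_minus1" "w \<in> H1" "\<And>\<phi>. \<phi> \<in> H1 \<Longrightarrow> L_dual \<nu> lam w \<phi> = \<rho> \<phi>"
  shows "L_inv \<nu> lam \<rho> = w"
  using assms by (intro L_dual_unique[of \<nu> lam] L_inv_H1) (auto simp: L_dual_L_inv)

lemma L_inv_inner_linear:
  fixes g h :: "(real ^ 'd) L2"
  assumes "0 < \<nu>" "0 < lam"
  shows "L_inv \<nu> lam (inner (a *\<^sub>R g + b *\<^sub>R h)) = a *\<^sub>R L_inv \<nu> lam (inner g) + b *\<^sub>R L_inv \<nu> lam (inner h)"
  using assms
  by (intro L_inv_eqI H_minus1_inner)
    (auto simp: L_dual_add_left L_dual_scaleR_left L_dual_L_inv L_inv_H1 H1_add H1_scaleR H_minus1_inner inner_add_left)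

lemma norm_L_inv_inner_le:
  fixes g :: "(real ^ 'd) L2"
  assumes "0 < \<nu>" "0 < lam"
  shows "norm (L_inv \<nu> lam (inner g)) \<le> norm g / lam"
proof -
  let ?w = "L_inv \<nu> lam (inner g)"
  have "lam * (norm ?w)\<^sup>2 \<le> L_dual \<nu> lam ?w ?w" using assms by (intro L_dual_ge) simp
  also have "\<dots> = inner g ?w" using assms by (intro L_dual_L_inv H_minus1_inner L_inv_H1)
  also have "\<dots> \<le> norm g * norm ?w" by (rule norm_cauchy_schwarz)
  finally have "(lam * norm ?w) * norm ?w \<le> norm g * norm ?w" by (simp add: power2_eq_square mult.assoc)
  then have "lam * norm ?w \<le> norm g"
    by (cases "norm ?w = 0") (auto dest: mult_right_le_imp_le)
  then show ?thesis using assms by (simp add: field_simps)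
qed

lemma tendsto_L_inv_inner:
  fixes g :: "(real ^ 'd) L2"
  assumes "0 < \<nu>" "0 < lam" "X \<longlonglongrightarrow> g"
  shows "(\<lambda>n. L_inv \<nu> lam (inner (X n))) \<longlonglongrightarrow> L_inv \<nu> lam (inner g)"
proof -
  have "(\<lambda>n. L_inv \<nu> lam (inner (X n)) - L_inv \<nu> lam (inner g)) \<longlonglongrightarrow> 0"
  proof (rule Lim_null_comparison)
    have "L_inv \<nu> lam (inner (X n)) - L_inv \<nu> lam (inner g) = L_inv \<nu> lam (inner (X n - g))" for n
      using L_inv_inner_linear[OF assms(1,2), of 1 "X n" "-1" g] by simp
    then show "\<forall>\<^sub>F n in sequentially. norm (L_inv \<nu> lam (inner (X n)) - L_inv \<nu> lam (inner g)) \<le> norm (X n - g) / lam"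
      by (intro always_eventually allI) (simp add: norm_L_inv_inner_le[OF assms(1,2)])
    have "(\<lambda>n. norm (X n - g) / lam) \<longlonglongrightarrow> 0 / lam"
      using assms by (intro tendsto_divide tendsto_const tendsto_norm_zero LIM_zero) auto
    then show "(\<lambda>n. norm (X n - g) / lam) \<longlonglongrightarrow> 0" by simp
  qed
  then show ?thesis by (simp add: LIM_zero_iff)
qed

lemma abs_L2_cmult: "sq_int f \<Longrightarrow> abs_L2 (\<lambda>x. c * f x) = c *\<^sub>R abs_L2 f"
  using scaleR_L2.abs_eq[of f c] by (simp add: L2_rel_refl)

lemma weak_deriv_wave:
  assumes "n \<in> lattice" "b \<in> Basis"
  shows "weak_deriv b (abs_L2 (wave n c)) = (2 * pi * (n \<bullet> b)) *\<^sub>R abs_L2 (wave n (c + pi / 2))"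
  using assms
  by (simp add: weak_deriv_trig trig.wave frechet_derivative_wave abs_L2_cmult trig_sq_int)

lemma weak_deriv_weak_deriv_wave:
  assumes "n \<in> lattice" "b \<in> Basis"
  shows "weak_deriv b (weak_deriv b (abs_L2 (wave n c))) = - ((2 * pi * (n \<bullet> b))\<^sup>2 *\<^sub>R abs_L2 (wave n c))"
proof -
  have "abs_L2 (wave n (c + pi / 2 + pi / 2)) = abs_L2 (\<lambda>x. (-1) * wave n c x)"
  proof (rule arg_cong[where f=abs_L2], rule ext)
    fix x
    have "2 * pi * (n \<bullet> x) + (c + pi / 2 + pi / 2) = (2 * pi * (n \<bullet> x) + c) + pi" by simp
    then show "wave n (c + pi / 2 + pi / 2) x = (-1) * wave n c x"
      unfolding wave_def by (simp only: cos_periodic_pi mult_minus1)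
  qed
  also have "\<dots> = (-1) *\<^sub>R abs_L2 (wave n c)"
    using assms by (intro abs_L2_cmult trig_sq_int trig.wave)
  finally show ?thesis
    using assms
    by (simp add: weak_deriv_wave weak_deriv_scaleR trig_H1 trig.wave power2_eq_square)
qed

lemma inner_weak_deriv_trig:
  assumes b: "b \<in> Basis" and u: "u \<in> H1" and \<phi>: "\<phi> \<in> trig"
  shows "inner (weak_deriv b u) (abs_L2 \<phi>) = - inner u (weak_deriv b (abs_L2 \<phi>))"
  using H1_has_weak_deriv[OF u b] trig_smooth[OF \<phi>] trig_periodic[OF \<phi>]
  unfolding has_weak_deriv_iff[OF b] weak_deriv_trig[OF \<phi> b] by simp

lemma L_dual_wave:
  assumes n: "n \<in> lattice" and u: "u \<in> H1"
  shows "L_dual \<nu> lam u (abs_L2 (wave n c)) =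
    (\<nu> * (\<Sum>b\<in>Basis. (2 * pi * (n \<bullet> b))\<^sup>2) + lam) * inner u (abs_L2 (wave n c))"
proof -
  have "inner (weak_deriv b u) (weak_deriv b (abs_L2 (wave n c))) = (2 * pi * (n \<bullet> b))\<^sup>2 * inner u (abs_L2 (wave n c))"
    if b: "b \<in> Basis" for b
  proof -
    have "(\<lambda>x. frechet_derivative (wave n c) (at x) b) \<in> trig" using trig_deriv[OF trig.wave[OF n]] by blast
    then have "inner (weak_deriv b u) (weak_deriv b (abs_L2 (wave n c)))
        = - inner u (weak_deriv b (weak_deriv b (abs_L2 (wave n c))))"
      using inner_weak_deriv_trig[OF b u] weak_deriv_trig[OF trig.wave[OF n] b] by simp
    then show ?thesis by (simp add: weak_deriv_weak_deriv_wave[OF n b])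
  qed
  then show ?thesis unfolding L_dual_def
    by (simp add: sum_distrib_right[symmetric] distrib_right)
qed

lemma L_dual_trig:
  assumes u: "u \<in> H2" and \<phi>: "\<phi> \<in> trig"
  shows "L_dual \<nu> lam u (abs_L2 \<phi>) = inner (L_op \<nu> lam u) (abs_L2 \<phi>)"
proof -
  have "inner (weak_deriv b u) (weak_deriv b (abs_L2 \<phi>)) = - inner (weak_deriv b (weak_deriv b u)) (abs_L2 \<phi>)"
    if b: "b \<in> Basis" for b
    using inner_weak_deriv_trig[OF b _ \<phi>, of "weak_deriv b u"] u b by (simp add: H2_def)
  then show ?thesis
    by (simp add: L_dual_def L_op_def laplacian_def inner_diff_left inner_add_left inner_sum_left sum_negf)
qed

text \<open>
  On \<open>H2\<close> the operator \<open>L_inv\<close>, defined with test functions in \<open>H1\<close>, inverts \<open>L_op\<close>, defined by weak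
  derivatives with smooth test functions. The difference \<open>d\<close> of the two candidates satisfies
  \<open>L_dual d \<phi> = 0\<close> for every plane wave \<open>\<phi>\<close>; as plane waves are eigenfunctions of the operator with
  positive eigenvalues, \<open>d\<close> is orthogonal to all of them. This replaces the density of smooth
  functions in \<open>H1\<close>.
\<close>

lemma L_inv_L_op:
  fixes u :: "(real ^ 'd) L2"
  assumes \<nu>: "0 < \<nu>" and lam: "0 < lam" and u: "u \<in> H2"
  shows "L_inv \<nu> lam (inner (L_op \<nu> lam u)) = u"
proof -
  let ?w = "L_inv \<nu> lam (inner (L_op \<nu> lam u))"
  have H1: "u \<in> H1" "?w \<in> H1" using u \<nu> lam by (auto simp: H2_def intro: L_inv_H1 H_minus1_inner)
  have "?w - u = 0"
  proof (rule L2_eq_0_if_wave)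
    fix n :: "real ^ 'd" and c assume n: "n \<in> lattice"
    let ?e = "abs_L2 (wave n c)"
    have "L_dual \<nu> lam (?w - u) ?e = L_dual \<nu> lam ?w ?e - L_dual \<nu> lam u ?e"
      by (rule L_dual_diff_left) (use H1 in auto)
    also have "\<dots> = 0"
      using \<nu> lam n u by (simp add: L_dual_L_inv H_minus1_inner trig_H1 trig.wave L_dual_trig)
    finally have "(\<nu> * (\<Sum>b\<in>Basis. (2 * pi * (n \<bullet> b))\<^sup>2) + lam) * inner (?w - u) ?e = 0"
      using L_dual_wave[OF n H1_diff[OF H1(2,1)], of \<nu> lam c] by simp
    moreover have "0 < \<nu> * (\<Sum>b\<in>Basis. (2 * pi * (n \<bullet> b))\<^sup>2) + lam"
      using \<nu> lam by (intro add_nonneg_pos mult_nonneg_nonneg sum_nonneg) auto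
    ultimately have "inner (?w - u) ?e = 0" by simp
    then show "(\<integral>x. L2_fun (?w - u) x * wave n c x \<partial>torus) = 0"
      using trig_sq_int[OF trig.wave[OF n]] by (simp add: inner_abs_L2)
  qed
  then show ?thesis by simp
qed

lemma L_dual_H2:
  fixes u :: "(real ^ 'd) L2"
  assumes "0 < \<nu>" "0 < lam" "u \<in> H2" "\<phi> \<in> H1"
  shows "L_dual \<nu> lam u \<phi> = inner (L_op \<nu> lam u) \<phi>"
  using L_dual_L_inv[OF assms(1,2) H_minus1_inner assms(4)] L_inv_L_op[OF assms(1-3)] by metis

section \<open>The constraint set and convergence of the iteration\<close>

lemma le_impulse_iff:
  assumes "finite J" "J \<noteq> {}"
  shows "le_impulse k J v u \<longleftrightarrow> (\<forall>\<xi>\<in>J. AE x in torus. L2_fun v x \<le> k x \<xi> + L2_fun u (x + \<xi>))"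
proof -
  have "L2_fun v x \<le> impulse k J (L2_fun u) x \<longleftrightarrow> (\<forall>\<xi>\<in>J. L2_fun v x \<le> k x \<xi> + L2_fun u (x + \<xi>))" for x
    unfolding impulse_def using assms by (intro le_cINF_iff) auto
  then show ?thesis
    unfolding le_impulse_def using assms by (simp add: AE_ball_countable countable_finite)
qed

lemma AE_L2_fun_shift_combination:
  "AE x in torus. L2_fun (a *\<^sub>R u + b *\<^sub>R v) (x + \<xi>) = a * L2_fun u (x + \<xi>) + b * L2_fun v (x + \<xi>)"
proof (rule AE_torus_shift[where P="\<lambda>x. L2_fun (a *\<^sub>R u + b *\<^sub>R v) x = a * L2_fun u x + b * L2_fun v x"])
  show "AE x in torus. L2_fun (a *\<^sub>R u + b *\<^sub>R v) x = a * L2_fun u x + b * L2_fun v x"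
    using L2_fun_add[of "a *\<^sub>R u" "b *\<^sub>R v"] L2_fun_scaleR[of a u] L2_fun_scaleR[of b v]
    by eventually_elim simp
  show "periodic (\<lambda>x. L2_fun (a *\<^sub>R u + b *\<^sub>R v) x = a * L2_fun u x + b * L2_fun v x)"
    using periodic_L2_fun[of "a *\<^sub>R u + b *\<^sub>R v"] periodic_L2_fun[of u] periodic_L2_fun[of v]
    by (simp add: periodic_def)
qed

lemma le_impulse_convex:
  assumes J: "finite J" "J \<noteq> {}" and "le_impulse k J u u" "le_impulse k J v v"
    and ab: "0 \<le> a" "0 \<le> b" "a + b = 1"
  shows "le_impulse k J (a *\<^sub>R u + b *\<^sub>R v) (a *\<^sub>R u + b *\<^sub>R v)"
  unfolding le_impulse_iff[OF J]
proof
  fix \<xi> assume \<xi>: "\<xi> \<in> J"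
  have "AE x in torus. L2_fun u x \<le> k x \<xi> + L2_fun u (x + \<xi>)" "AE x in torus. L2_fun v x \<le> k x \<xi> + L2_fun v (x + \<xi>)"
    using assms \<xi> by (simp_all add: le_impulse_iff)
  then show "AE x in torus. L2_fun (a *\<^sub>R u + b *\<^sub>R v) x \<le> k x \<xi> + L2_fun (a *\<^sub>R u + b *\<^sub>R v) (x + \<xi>)"
    using AE_L2_fun_shift_combination[of a u b v 0] AE_L2_fun_shift_combination[of a u b v \<xi>]
  proof eventually_elim
    case (elim x)
    have "a * L2_fun u x + b * L2_fun v x \<le> a * (k x \<xi> + L2_fun u (x + \<xi>)) + b * (k x \<xi> + L2_fun v (x + \<xi>))"
      using elim ab by (intro add_mono mult_left_mono) auto
    also have "\<dots> = (a + b) * k x \<xi> + (a * L2_fun u (x + \<xi>) + b * L2_fun v (x + \<xi>))"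
      by (simp add: algebra_simps)
    finally show ?case using elim ab by simp
  qed
qed

text \<open>
  A subsequence converges almost everywhere, and so do its translates by the finitely many shifts.
\<close>

lemma le_impulse_lim:
  assumes J: "finite J" "J \<noteq> {}" and X: "\<And>n. le_impulse k J (X n) (X n)" "X \<longlonglongrightarrow> u"
  shows "le_impulse k J u u"
  unfolding le_impulse_iff[OF J]
proof
  fix \<xi> assume \<xi>: "\<xi> \<in> J"
  obtain r :: "nat \<Rightarrow> nat" where r: "AE x in torus. (\<lambda>n. L2_fun (X (r n)) x) \<longlonglongrightarrow> L2_fun u x"
    using L2_tendsto_AE_subseq[OF X(2)] by blast
  have "periodic (\<lambda>x. (\<lambda>n. L2_fun (X (r n)) x) \<longlonglongrightarrow> L2_fun u x)"
    unfolding periodic_def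
  proof (intro allI ballI)
    fix x b :: 'a assume "b \<in> Basis"
    then have "L2_fun v (x + b) = L2_fun v x" for v
      using periodic_L2_fun[of v] by (simp add: periodic_def)
    then show "((\<lambda>n. L2_fun (X (r n)) (x + b)) \<longlonglongrightarrow> L2_fun u (x + b)) = ((\<lambda>n. L2_fun (X (r n)) x) \<longlonglongrightarrow> L2_fun u x)"
      by simp
  qed
  from AE_torus_shift[OF r this, of \<xi>]
  have r': "AE x in torus. (\<lambda>n. L2_fun (X (r n)) (x + \<xi>)) \<longlonglongrightarrow> L2_fun u (x + \<xi>)" .
  have "\<forall>n. AE x in torus. L2_fun (X (r n)) x \<le> k x \<xi> + L2_fun (X (r n)) (x + \<xi>)"
    using X(1) \<xi> by (simp add: le_impulse_iff[OF J])
  then have "AE x in torus. \<forall>n. L2_fun (X (r n)) x \<le> k x \<xi> + L2_fun (X (r n)) (x + \<xi>)"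
    unfolding AE_all_countable .
  then show "AE x in torus. L2_fun u x \<le> k x \<xi> + L2_fun u (x + \<xi>)"
    using r r'
  proof eventually_elim
    case (elim x)
    show ?case
      by (rule LIMSEQ_le[OF elim(2) tendsto_add[OF tendsto_const elim(3)]]) (use elim(1) in auto)
  qed
qed

lemma convex_K':
  fixes J :: "(real ^ 'd) set"
  assumes "0 < \<nu>" "0 < lam" "finite J" "J \<noteq> {}"
  shows "convex (K' \<nu> lam k J)"
  unfolding convex_def K'_def using assms
  by (auto simp: L_inv_inner_linear intro!: le_impulse_convex)

lemma closed_K':
  fixes J :: "(real ^ 'd) set"
  assumes "0 < \<nu>" "0 < lam" "finite J" "J \<noteq> {}"
  shows "closed (K' \<nu> lam k J)"
  unfolding closed_sequential_limits
proof (intro allI impI, elim conjE)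
  fix X g assume X: "\<forall>n. X n \<in> K' \<nu> lam k J" and l: "X \<longlonglongrightarrow> g"
  show "g \<in> K' \<nu> lam k J"
    unfolding K'_def mem_Collect_eq
    by (rule le_impulse_lim[OF assms(3,4) _ tendsto_L_inv_inner[OF assms(1,2) l]])
      (use X in \<open>simp add: K'_def\<close>)
qed

lemma inner_nonneg:
  assumes "nonneg u" "nonneg v"
  shows "0 \<le> inner u v"
  unfolding inner_L2_eq
  by (rule integral_nonneg_AE) (use assms[unfolded nonneg_def] in eventually_elim, simp)

lemma le_impulse_mono:
  assumes "le_impulse k J v u" "AE x in torus. L2_fun w x \<le> L2_fun v x"
  shows "le_impulse k J w u"
  using assms unfolding le_impulse_def by eventually_elim simp

text \<open>
  Lowering \<open>u\<close> by a nonnegative trigonometric polynomial keeps it below \<open>M u\<close>, hence gives a competitor in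
  the first variational inequality.
\<close>

lemma mfg_solution_nonneg:
  assumes "mfg_solution \<nu> lam \<rho> f k J u m"
  shows "nonneg (f m + \<nu> *\<^sub>R laplacian u - lam *\<^sub>R u)"
proof (rule nonneg_if_trig)
  fix \<phi> :: "'a \<Rightarrow> real" assume \<phi>: "\<phi> \<in> trig" "\<And>x. 0 \<le> \<phi> x"
  let ?h = "f m + \<nu> *\<^sub>R laplacian u - lam *\<^sub>R u"
  have "u \<in> H1" "le_impulse k J u u" using assms by (auto simp: mfg_solution_def H2_def)
  moreover have "AE x in torus. L2_fun (u - abs_L2 \<phi>) x \<le> L2_fun u x"
    using L2_fun_diff[of u "abs_L2 \<phi>"] L2_fun_abs[OF trig_sq_int[OF \<phi>(1)]]
    by eventually_elim (use \<phi>(2) in simp)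
  ultimately have "inner ?h ((u - abs_L2 \<phi>) - u) \<le> 0"
    using assms trig_H1[OF \<phi>(1)] unfolding mfg_solution_def
    by (blast intro: H1_diff le_impulse_mono)
  then show "0 \<le> (\<integral>x. L2_fun ?h x * \<phi> x \<partial>torus)"
    using trig_sq_int[OF \<phi>(1)] by (simp add: inner_abs_L2)
qed

text \<open>
  The second variational inequality, read in the variable \<open>g = L v\<close>, is the \<open>L2\<close> variational inequality on
  \<open>K'\<close>; equivalently, \<open>L u\<close> is a fixed point of the projected step.
\<close>

lemma mfg_solution_dual:
  fixes u m :: "(real ^ 'd) L2"
  assumes \<nu>: "0 < \<nu>" and lam: "0 < lam" and \<rho>: "\<rho> \<in> H_minus1" and sol: "mfg_solution \<nu> lam \<rho> f k J u m"
    and g: "g \<in> K' \<nu> lam k J"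
  shows "0 \<le> inner (m - L_inv \<nu> lam \<rho>) (g - L_op \<nu> lam u)"
proof -
  let ?v = "L_inv \<nu> lam (inner g)" and ?r = "L_inv \<nu> lam \<rho>"
  have H: "u \<in> H2" "m \<in> H1" "u \<in> H1" using sol by (auto simp: mfg_solution_def H2_def)
  have v: "?v \<in> H1" and r: "?r \<in> H1" using \<nu> lam \<rho> by (auto intro: L_inv_H1 H_minus1_inner)
  have dv: "L_dual \<nu> lam w ?v = inner g w" if "w \<in> H1" for w
    using L_dual_L_inv[OF \<nu> lam H_minus1_inner that] by (simp add: L_dual_commute)
  have du: "L_dual \<nu> lam w u = inner (L_op \<nu> lam u) w" if "w \<in> H1" for w
    using L_dual_H2[OF \<nu> lam H(1) that] by (simp add: L_dual_commute)
  have "0 \<le> L_dual \<nu> lam m (?v - u) - \<rho> (?v - u)"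
    using sol v g unfolding mfg_solution_def K'_def by blast
  also have "\<rho> (?v - u) = L_dual \<nu> lam ?r (?v - u)"
    using \<nu> lam \<rho> v H by (simp add: L_dual_L_inv H1_diff)
  finally have "0 \<le> (inner g m - inner (L_op \<nu> lam u) m) - (inner g ?r - inner (L_op \<nu> lam u) ?r)"
    using v H r by (simp add: L_dual_diff_right dv du)
  also have "\<dots> = inner (m - ?r) (g - L_op \<nu> lam u)"
    by (simp add: inner_diff_left inner_diff_right inner_commute[of m] inner_commute[of ?r])
  finally show ?thesis .
qed

lemma LIMSEQ_0_if_telescoping:
  fixes a b :: "nat \<Rightarrow> real"
  assumes "0 < c" "\<And>n. 0 \<le> a n" "\<And>n. 0 \<le> b n" "\<And>n. b (Suc n) \<le> b n - c * a n"
  shows "a \<longlonglongrightarrow> 0"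
proof -
  have "c * (\<Sum>i<n. a i) \<le> b 0 - b n" for n
  proof (induction n)
    case (Suc n)
    then show ?case using assms(4)[of n] by (simp add: distrib_left)
  qed simp
  then have "(\<Sum>i<n. a i) \<le> b 0 / c" for n
    using assms(1) assms(3)[of n] by (simp add: field_simps) (smt (verit))
  then have "summable a"
    using assms(2) by (intro summableI_nonneg_bounded[where x="b 0 / c"]) auto
  then show ?thesis by (rule summable_LIMSEQ_zero)
qed

text \<open>
  For \<open>\<delta> < 2 \<alpha>\<close> one projected gradient step brings \<open>g\<close> closer by an amount controlled by \<open>mn - m\<close>. Here \<open>gn\<close>, \<open>mn\<close> are the
  current iterates, \<open>g'\<close> the next one, and \<open>(g, m)\<close> the limit, for which \<open>g\<close> is a fixed point of the
  projected step; \<open>r\<close> stands for \<open>L\<close> inverse of the entry rate.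
\<close>

lemma Uzawa_step:
  fixes g g' gn m mn r :: "'a::{real_inner, complete_space}"
  assumes A: "closed A" "convex A" "g \<in> A"
    and step: "g' = proj A (gn - \<delta> *\<^sub>R (mn - r))"
    and var: "\<And>y. y \<in> A \<Longrightarrow> 0 \<le> inner (m - r) (y - g)"
    and mono: "\<alpha> * (norm (mn - m))\<^sup>2 \<le> inner (gn - g) (mn - m)"
    and \<delta>: "0 \<le> \<delta>"
  shows "(norm (g' - g))\<^sup>2 \<le> (norm (gn - g))\<^sup>2 - \<delta> * (2 * \<alpha> - \<delta>) * (norm (mn - m))\<^sup>2"
proof -
  define d where "d = (gn - g) - \<delta> *\<^sub>R (mn - m)"
  have "g' \<in> A" unfolding step by (rule proj_in) (use A in auto)
  then have 1: "0 \<le> \<delta> * inner (m - r) (g' - g)" using var \<delta> by simp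
  have 2: "inner ((gn - \<delta> *\<^sub>R (mn - r)) - g') (g - g') \<le> 0"
    unfolding step by (rule proj_variational[OF A])
  have "inner (g' - g) (g' - g) \<le> inner d (g' - g)"
    using 1 2 unfolding d_def
    by (simp add: inner_diff_left inner_diff_right inner_commute algebra_simps)
  also have "\<dots> \<le> norm d * norm (g' - g)" by (rule norm_cauchy_schwarz)
  finally have "norm (g' - g) * norm (g' - g) \<le> norm d * norm (g' - g)"
    by (simp add: power2_norm_eq_inner[symmetric] power2_eq_square)
  then have "norm (g' - g) \<le> norm d"
    by (cases "norm (g' - g) = 0") (auto dest: mult_right_le_imp_le)
  then have "(norm (g' - g))\<^sup>2 \<le> (norm d)\<^sup>2" by (intro power_mono) auto
  also have "\<dots> = (norm (gn - g))\<^sup>2 - 2 * \<delta> * inner (gn - g) (mn - m) + \<delta>\<^sup>2 * (norm (mn - m))\<^sup>2"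
    unfolding d_def power2_norm_eq_inner
    by (simp add: inner_diff_left inner_diff_right inner_commute algebra_simps power2_eq_square)
  also have "\<dots> \<le> (norm (gn - g))\<^sup>2 - 2 * \<delta> * (\<alpha> * (norm (mn - m))\<^sup>2) + \<delta>\<^sup>2 * (norm (mn - m))\<^sup>2"
    using mono \<delta> by (simp add: mult_left_mono)
  finally show ?thesis by (simp add: algebra_simps power2_eq_square)
qed

theorem theorem4:
  fixes \<nu> lam \<alpha> \<delta> :: real
    and \<rho> :: "(real ^ 'd) L2 \<Rightarrow> real"
    and f :: "(real ^ 'd) L2 \<Rightarrow> (real ^ 'd) L2"
    and k :: "real ^ 'd \<Rightarrow> real ^ 'd \<Rightarrow> real"
    and J :: "(real ^ 'd) set"
    and u m :: "(real ^ 'd) L2"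
    and us ms :: "nat \<Rightarrow> (real ^ 'd) L2"
  assumes "\<nu> > 0" and "lam > 0"
    and "\<rho> \<in> H_minus1"
    and "continuous_on UNIV f"
    and "\<exists>C. \<forall>\<mu>. nonneg \<mu> \<longrightarrow> (AE x in torus. C \<le> L2_fun (f \<mu>) x)"
    and "\<alpha> > 0" and "monotone_with \<alpha> f"
    and "finite J" and "J \<noteq> {}"
    and "smooth (\<lambda>(x, \<xi>). k x \<xi>)" and "periodic (\<lambda>(x, \<xi>). k x \<xi>)"
    and "\<forall>x \<xi>. 0 \<le> k x \<xi>"
    and "\<exists>q\<in>W2_inf. AE x in torus. L2_fun q x = (INF \<xi>\<in>J. k x \<xi>)"
    and "\<exists>k\<^sub>0>0. \<forall>x. \<forall>\<xi>\<in>J. k\<^sub>0 \<le> k x \<xi>"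
    and "0 < \<delta>" and "\<delta> < 2 * \<alpha>"
    and "us 0 \<in> H2" and "le_impulse k J (us 0) (us 0)"
    and "\<forall>n. nonneg (ms n) \<and>
      (\<forall>\<mu>. nonneg \<mu> \<longrightarrow>
        inner (f (ms n) + \<nu> *\<^sub>R laplacian (us n) - lam *\<^sub>R us n) (\<mu> - ms n) \<ge> 0)"
    and "\<forall>n. us (Suc n) \<in> H2 \<and>
      L_op \<nu> lam (us (Suc n)) =
        proj (K' \<nu> lam k J) (L_op \<nu> lam (us n) - \<delta> *\<^sub>R (ms n - L_inv \<nu> lam \<rho>))"
    and "mfg_solution \<nu> lam \<rho> f k J u m"
  shows "ms \<longlonglongrightarrow> m"
proof -
  note \<nu> = assms(1) and lam = assms(2) and \<rho> = assms(3) and mono = assms(7)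
    and J = assms(8,9) and \<delta> = assms(15,16) and ms = assms(19) and us = assms(20) and sol = assms(21)
  let ?A = "K' \<nu> lam k J"
  define g where "g = L_op \<nu> lam u"
  define gs where "gs n = L_op \<nu> lam (us n)" for n
  have L: "h + \<nu> *\<^sub>R laplacian v - lam *\<^sub>R v = h - L_op \<nu> lam v" for h v :: "(real ^ 'd) L2"
    by (simp add: L_op_def)
  have u: "u \<in> H2" and m: "nonneg m" using sol by (auto simp: mfg_solution_def)
  have gA: "g \<in> ?A"
    using sol by (simp add: K'_def g_def L_inv_L_op[OF \<nu> lam u] mfg_solution_def)
  have mono_n: "\<alpha> * (norm (ms n - m))\<^sup>2 \<le> inner (gs n - g) (ms n - m)" for n
  proof -
    \<comment> \<open>Both \<open>m\<close> and \<open>ms n\<close> are nonnegative, so each is a competitor in the complementarity problem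
      of the other.\<close>
    have "0 \<le> inner (f (ms n) - gs n) (m - ms n)"
      using ms m unfolding L gs_def by blast
    moreover have "inner (f m - g) m = 0"
      using sol unfolding mfg_solution_def L g_def by blast
    moreover have "0 \<le> inner (f m - g) (ms n)"
      using mfg_solution_nonneg[OF sol] ms unfolding L g_def by (blast intro: inner_nonneg)
    moreover have "\<alpha> * (norm (ms n - m))\<^sup>2 \<le> inner (f (ms n) - f m) (ms n - m)"
      using mono unfolding monotone_with_def by blast
    ultimately show ?thesis
      by (simp add: inner_diff_left inner_diff_right)
  qed
  have step: "(norm (gs (Suc n) - g))\<^sup>2 \<le> (norm (gs n - g))\<^sup>2 - \<delta> * (2 * \<alpha> - \<delta>) * (norm (ms n - m))\<^sup>2" for n
  proof (rule Uzawa_step[where A="?A" and r="L_inv \<nu> lam \<rho>"])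
    show "gs (Suc n) = proj ?A (gs n - \<delta> *\<^sub>R (ms n - L_inv \<nu> lam \<rho>))"
      using us by (simp add: gs_def)
    show "0 \<le> inner (m - L_inv \<nu> lam \<rho>) (y - g)" if "y \<in> ?A" for y
      unfolding g_def by (rule mfg_solution_dual[OF \<nu> lam \<rho> sol that])
  qed (use \<delta> gA mono_n closed_K'[OF \<nu> lam J] convex_K'[OF \<nu> lam J] in auto)
  have "(\<lambda>n. (norm (ms n - m))\<^sup>2) \<longlonglongrightarrow> 0"
    by (rule LIMSEQ_0_if_telescoping[where c="\<delta> * (2 * \<alpha> - \<delta>)" and b="\<lambda>n. (norm (gs n - g))\<^sup>2"])
      (use \<delta> step in auto)
  then have "(\<lambda>n. sqrt ((norm (ms n - m))\<^sup>2)) \<longlonglongrightarrow> sqrt 0" by (rule tendsto_real_sqrt)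
  then have "(\<lambda>n. ms n - m) \<longlonglongrightarrow> 0" by (simp add: tendsto_norm_zero_iff)
  then show ?thesis by (simp add: LIM_zero_iff)
qed

end
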